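(* Let $\Gamma$ be a self-adjoint, positive, unbounded operator with a discrete spectrum on a separable Hilbert space $H$, and let $L$ be a self-adjoint operator on $H$ such that for any $\psi\in H^1(\Gamma)$ and $t>0$ $$\|L\psi\|_H\le C\|\psi\|_{H^1(\Gamma)}\quad\text{and}\quad \|e^{iLt}\psi\|_{H^1(\Gamma)}\le B(t)\|\psi\|_{H^1(\Gamma)},$$ with both the constant $C$ and the function $B(t)<\infty$ independent of $\psi$, and $B\in L^2_{\rm loc}[0,\infty)$. For $A\in\mathbb{R}$ and $\phi_0\in H$ let $\phi^A(t)$ be the solution of $$\frac{d}{dt}\phi^A(t)=iAL\phi^A(t)-\Gamma\phi^A(t),\qquad \phi^A(0)=\phi_0.$$ Then the following two statements are equivalent: (i) For any $\tau,\delta>0$ there exists $A(\tau,\delta)$ such that for any $A>A(\tau,\delta)$ and any $\phi_0\in H$ with $\|\phi_0\|_H=1$, the solution satisfies $\|\phi^A(\tau)\|_H^2<\delta$. (ii) The operator $L$ has no eigenvectors lying in $H^1(\Gamma)$.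
   Context: Discrete spectrum: $\Gamma$ has eigenvalues $0<\lambda_1\le\lambda_2\le\dots$ (with multiplicity), $\lambda_n\to\infty$, and corresponding orthonormal eigenvectors $e_1,e_2,\dots$ forming a basis of $H$. The Sobolev space $H^m(\Gamma)$ consists of all $\psi=\sum_jc_je_j$ with $\|\psi\|_{H^m(\Gamma)}^2=\sum_j\lambda_j^m|c_j|^2<\infty$; in particular $H^2(\Gamma)$ is the domain of $\Gamma$. The first inequality includes that $H^1(\Gamma)$ is contained in the domain of $L$. $e^{iLt}$ is the unitary group generated by $L$. For $\phi_0\in H$ the equation has a unique solution with $\phi\in L^2([0,T],H^1(\Gamma))\cap C([0,T],H)$ and $\phi'\in L^2([0,T],H^{-1}(\Gamma))$ for every $T>0$ (equivalently, $\phi^A(t)$ is given by the strongly continuous contraction semigroup generated by $iAL-\Gamma$). *)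

theory Defs
  imports "HOL-Analysis.Analysis"
begin

section \<open>Complex Hilbert spaces\<close>

text \<open>The complex structure is put on top of the class \<^class>\<open>real_inner\<close>, so that norm, topology
  and real scalar multiplication are those of the library.  The complex inner product is linear in
  its second argument, and its real part is the library's real inner product.\<close>

class complex_inner = real_inner +
  fixes scaleC :: "complex \<Rightarrow> 'a \<Rightarrow> 'a" (infixr \<open>*\<^sub>C\<close> 75)
    and cinner :: "'a \<Rightarrow> 'a \<Rightarrow> complex"
  assumes scaleC_add_right: "a *\<^sub>C (x + y) = a *\<^sub>C x + a *\<^sub>C y"
    and scaleC_add_left: "(a + b) *\<^sub>C x = a *\<^sub>C x + b *\<^sub>C x"
    and scaleC_scaleC: "a *\<^sub>C (b *\<^sub>C x) = (a * b) *\<^sub>C x"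
    and scaleR_scaleC: "r *\<^sub>R x = complex_of_real r *\<^sub>C x"
    and cinner_commute: "cinner x y = cnj (cinner y x)"
    and cinner_add_right: "cinner x (y + z) = cinner x y + cinner x z"
    and cinner_scaleC_right: "cinner x (a *\<^sub>C y) = a * cinner x y"
    and inner_eq_Re_cinner: "x \<bullet> y = Re (cinner x y)"

class chilbert_space = complex_inner + complete_space

section \<open>Unbounded operators\<close>

text \<open>An operator is given by its domain \<open>D\<close> and a function \<open>T\<close>, whose values outside \<open>D\<close> play no
  role.\<close>

definition csubspace :: "'h::complex_inner set \<Rightarrow> bool" where
  "csubspace D \<longleftrightarrow> 0 \<in> D \<and> (\<forall>x\<in>D. \<forall>y\<in>D. x + y \<in> D) \<and> (\<forall>a. \<forall>x\<in>D. a *\<^sub>C x \<in> D)"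

definition clinear_on :: "'h::complex_inner set \<Rightarrow> ('h \<Rightarrow> 'h) \<Rightarrow> bool" where
  "clinear_on D T \<longleftrightarrow> (\<forall>x\<in>D. \<forall>y\<in>D. T (x + y) = T x + T y) \<and> (\<forall>a. \<forall>x\<in>D. T (a *\<^sub>C x) = a *\<^sub>C T x)"

definition densely_defined_operator :: "'h::complex_inner set \<Rightarrow> ('h \<Rightarrow> 'h) \<Rightarrow> bool" where
  "densely_defined_operator D T \<longleftrightarrow> csubspace D \<and> closure D = UNIV \<and> clinear_on D T"

definition operator_graph :: "'h set \<Rightarrow> ('h \<Rightarrow> 'h) \<Rightarrow> ('h \<times> 'h) set" where
  "operator_graph D T = {(x, T x) | x. x \<in> D}"

text \<open>For a densely defined operator this set of pairs is the graph of the adjoint operator.\<close>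

definition adjoint_graph :: "'h::complex_inner set \<Rightarrow> ('h \<Rightarrow> 'h) \<Rightarrow> ('h \<times> 'h) set" where
  "adjoint_graph D T = {(y, z). \<forall>x\<in>D. cinner (T x) y = cinner x z}"

definition self_adjoint :: "'h::complex_inner set \<Rightarrow> ('h \<Rightarrow> 'h) \<Rightarrow> bool" where
  "self_adjoint D T \<longleftrightarrow> densely_defined_operator D T \<and> adjoint_graph D T = operator_graph D T"

definition positive_operator :: "'h::complex_inner set \<Rightarrow> ('h \<Rightarrow> 'h) \<Rightarrow> bool" where
  "positive_operator D T \<longleftrightarrow>
     (\<forall>x\<in>D. x \<noteq> 0 \<longrightarrow> Im (cinner x (T x)) = 0 \<and> 0 < Re (cinner x (T x)))"

definition unbounded_operator :: "'h::complex_inner set \<Rightarrow> ('h \<Rightarrow> 'h) \<Rightarrow> bool" where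
  "unbounded_operator D T \<longleftrightarrow> \<not> (\<exists>K. \<forall>x\<in>D. norm (T x) \<le> K * norm x)"

definition eigenvector :: "'h::complex_inner set \<Rightarrow> ('h \<Rightarrow> 'h) \<Rightarrow> 'h \<Rightarrow> bool" where
  "eigenvector D T x \<longleftrightarrow> x \<in> D \<and> x \<noteq> 0 \<and> (\<exists>\<mu>. T x = \<mu> *\<^sub>C x)"

definition orthonormal_basis :: "(nat \<Rightarrow> 'h::complex_inner) \<Rightarrow> bool" where
  "orthonormal_basis e \<longleftrightarrow>
     (\<forall>i j. cinner (e i) (e j) = (if i = j then 1 else 0)) \<and>
     (\<forall>x. \<exists>c. (\<lambda>j. c j *\<^sub>C e j) sums x)"

text \<open>The eigenvalues are enumerated from index 0.  Multiplicities are accounted for because the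
  \<open>e j\<close> form a basis.\<close>

definition discrete_spectrum ::
    "'h::complex_inner set \<Rightarrow> ('h \<Rightarrow> 'h) \<Rightarrow> (nat \<Rightarrow> real) \<Rightarrow> (nat \<Rightarrow> 'h) \<Rightarrow> bool" where
  "discrete_spectrum D T lam e \<longleftrightarrow>
     0 < lam 0 \<and> mono lam \<and> filterlim lam at_top sequentially \<and>
     orthonormal_basis e \<and> (\<forall>j. e j \<in> D \<and> T (e j) = complex_of_real (lam j) *\<^sub>C e j)"

text \<open>\<open>U\<close> is the unitary group \<open>e\<^sup>i\<^sup>L\<^sup>t\<close>: strongly continuous, with generator \<open>iL\<close> including the
  equality of domains.\<close>

definition unitary :: "('h::complex_inner \<Rightarrow> 'h) \<Rightarrow> bool" where
  "unitary V \<longleftrightarrow> clinear_on UNIV V \<and> surj V \<and> (\<forall>x y. cinner (V x) (V y) = cinner x y)"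

definition generator_graph :: "(real \<Rightarrow> 'h \<Rightarrow> 'h::real_normed_vector) \<Rightarrow> ('h \<times> 'h) set" where
  "generator_graph U = {(x, y). ((\<lambda>t. U t x) has_vector_derivative y) (at 0)}"

definition unitary_group_generated_by ::
    "'h::complex_inner set \<Rightarrow> ('h \<Rightarrow> 'h) \<Rightarrow> (real \<Rightarrow> 'h \<Rightarrow> 'h) \<Rightarrow> bool" where
  "unitary_group_generated_by D L U \<longleftrightarrow>
     (\<forall>t. unitary (U t)) \<and> U 0 = id \<and> (\<forall>s t. U (s + t) = U s \<circ> U t) \<and>
     (\<forall>x. continuous_on UNIV (\<lambda>t. U t x)) \<and>
     generator_graph U = operator_graph D (\<lambda>x. \<i> *\<^sub>C L x)"

section \<open>Sobolev spaces\<close>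

text \<open>An element of the Sobolev space of order \<open>m\<close> is a series \<open>\<Sum>j. c j *\<^sub>C e j\<close>, which for negative
  \<open>m\<close> need not converge in the Hilbert space.  Therefore the spaces are first defined on the level
  of coefficient sequences, for all integers \<open>m\<close>.\<close>

definition sobolev_coeffs :: "(nat \<Rightarrow> real) \<Rightarrow> int \<Rightarrow> (nat \<Rightarrow> complex) set" where
  "sobolev_coeffs lam m = {c. summable (\<lambda>j. lam j powi m * (cmod (c j))\<^sup>2)}"

definition sobolev_coeffs_norm :: "(nat \<Rightarrow> real) \<Rightarrow> int \<Rightarrow> (nat \<Rightarrow> complex) \<Rightarrow> real" where
  "sobolev_coeffs_norm lam m c = sqrt (\<Sum>j. lam j powi m * (cmod (c j))\<^sup>2)"

definition coeffs :: "(nat \<Rightarrow> 'h::complex_inner) \<Rightarrow> 'h \<Rightarrow> nat \<Rightarrow> complex" where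
  "coeffs e x j = cinner (e j) x"

text \<open>For \<open>m \<ge> 0\<close> the Sobolev space consists of vectors of the Hilbert space.\<close>

definition sobolev :: "(nat \<Rightarrow> real) \<Rightarrow> (nat \<Rightarrow> 'h::complex_inner) \<Rightarrow> nat \<Rightarrow> 'h set" where
  "sobolev lam e m = {x. coeffs e x \<in> sobolev_coeffs lam (int m)}"

definition sobolev_norm :: "(nat \<Rightarrow> real) \<Rightarrow> (nat \<Rightarrow> 'h::complex_inner) \<Rightarrow> nat \<Rightarrow> 'h \<Rightarrow> real" where
  "sobolev_norm lam e m x = sobolev_coeffs_norm lam (int m) (coeffs e x)"

section \<open>The evolution equation\<close>

definition L2_loc_nonneg :: "(real \<Rightarrow> real) \<Rightarrow> bool" where
  "L2_loc_nonneg B \<longleftrightarrow> (\<forall>T>0. B \<in> borel_measurable (lebesgue_on {0..T}) \<and>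
     integrable (lebesgue_on {0..T}) (\<lambda>t. (B t)\<^sup>2))"

text \<open>Functions on \<open>[0,T]\<close> that are square integrable with values in the Sobolev space of order
  \<open>m\<close>, given by their coefficients.  This space is a separable Hilbert space, so (strong)
  measurability amounts to measurability of each coefficient.\<close>

definition L2_sobolev :: "(nat \<Rightarrow> real) \<Rightarrow> int \<Rightarrow> real \<Rightarrow> (real \<Rightarrow> nat \<Rightarrow> complex) \<Rightarrow> bool" where
  "L2_sobolev lam m T g \<longleftrightarrow>
     (\<forall>j. (\<lambda>t. g t j) \<in> borel_measurable (lebesgue_on {0..T})) \<and>
     (AE t in lebesgue_on {0..T}. g t \<in> sobolev_coeffs lam m) \<and>
     integrable (lebesgue_on {0..T}) (\<lambda>t. (sobolev_coeffs_norm lam m (g t))\<^sup>2)"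

text \<open>\<open>g\<close> is the weak time derivative of \<open>u\<close> on \<open>[0,T]\<close>, i.e. \<open>u(t) = u(0) + \<integral>\<^sub>0\<^sup>t g(s) ds\<close>.  The
  coefficient functionals separate points of the Sobolev spaces, so the identity is stated
  coefficientwise.\<close>

definition weak_derivative ::
    "real \<Rightarrow> (real \<Rightarrow> nat \<Rightarrow> complex) \<Rightarrow> (real \<Rightarrow> nat \<Rightarrow> complex) \<Rightarrow> bool" where
  "weak_derivative T u g \<longleftrightarrow>
     (\<forall>j. integrable (lebesgue_on {0..T}) (\<lambda>s. g s j) \<and>
          (\<forall>t\<in>{0..T}. u t j = u 0 j + integral\<^sup>L (lebesgue_on {0..t}) (\<lambda>s. g s j)))"

text \<open>\<open>\<phi>\<close> solves \<open>\<phi>' = iAL\<phi> - \<Gamma>\<phi>\<close>, \<open>\<phi>(0) = \<phi>\<^sub>0\<close> on \<open>[0,\<infinity>)\<close>, with \<open>\<phi> \<in> L\<^sup>2([0,T],H\<^sup>1(\<Gamma>)) \<inter> C([0,T],H)\<close>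
  and \<open>\<phi>' \<in> L\<^sup>2([0,T],H\<^sup>-\<^sup>1(\<Gamma>))\<close>.  For almost every \<open>t\<close> the value \<open>\<phi> t\<close> lies in \<open>H\<^sup>1(\<Gamma>)\<close>, which is
  contained in the domain of \<open>L\<close> but not in that of \<open>\<Gamma>\<close>; accordingly \<open>\<Gamma>\<close> is extended to a map from
  \<open>H\<^sup>1(\<Gamma>)\<close> to \<open>H\<^sup>-\<^sup>1(\<Gamma>)\<close>, multiplying the \<open>j\<close>th coefficient by \<open>lam j\<close>.\<close>

definition is_solution ::
    "(nat \<Rightarrow> real) \<Rightarrow> (nat \<Rightarrow> 'h::complex_inner) \<Rightarrow> ('h \<Rightarrow> 'h) \<Rightarrow> real \<Rightarrow> 'h \<Rightarrow> (real \<Rightarrow> 'h) \<Rightarrow> bool" where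
  "is_solution lam e L A \<phi>0 \<phi> \<longleftrightarrow>
     \<phi> 0 = \<phi>0 \<and>
     (\<forall>T>0. continuous_on {0..T} \<phi> \<and>
        L2_sobolev lam 1 T (\<lambda>t. coeffs e (\<phi> t)) \<and>
        (\<exists>\<phi>'. L2_sobolev lam (- 1) T \<phi>' \<and>
           weak_derivative T (\<lambda>t. coeffs e (\<phi> t)) \<phi>' \<and>
           (AE t in lebesgue_on {0..T}. \<forall>j.
              \<phi>' t j = \<i> * complex_of_real A * coeffs e (L (\<phi> t)) j
                       - complex_of_real (lam j) * coeffs e (\<phi> t) j)))"

end

theory Submission
  imports Defs "HOL-Complex_Analysis.Great_Picard"
begin

text \<open>An eigenvector \<open>\<psi> \<in> H\<^sup>1\<close> of \<open>L\<close> is only rotated by the fast flow, so dissipation moves the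
  overlap \<open>\<langle>\<psi>, \<phi>\<^sup>A(t)\<rangle>\<close> at a rate independent of \<open>A\<close>.

  Conversely, suppose that along some \<open>A\<^sub>n \<rightarrow> \<infinity>\<close> solutions \<open>\<phi>\<^sub>n\<close> of initial norm \<open>1\<close> have norm bounded
  below on \<open>[0,\<tau>]\<close>.  Consider the positive operators \<open>X\<^sub>n = \<integral>\<^sub>0\<^sup>\<tau> |\<phi>\<^sub>n(t)\<rangle>\<langle>\<phi>\<^sub>n(t)| dt\<close>.  The energy
  inequality bounds \<open>\<integral> \<parallel>\<phi>\<^sub>n\<parallel>\<^sup>2\<close> in the \<open>H\<^sup>1\<close> norm by \<open>1/2\<close>, so the \<open>X\<^sub>n\<close> map bounded sets into a common
  compact set, and a subsequence converges to some \<open>X \<noteq> 0\<close> with range in \<open>H\<^sup>1\<close>.  Integrating the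
  equation for \<open>|\<phi>\<^sub>n\<rangle>\<langle>\<phi>\<^sub>n|\<close> over \<open>[0,\<tau>]\<close> shows that the commutator of \<open>L\<close> and \<open>X\<^sub>n\<close> is \<open>O(1/A\<^sub>n)\<close> on
  basis vectors, so \<open>X\<close> commutes with \<open>L\<close>, and \<open>L\<close> has an eigenvector in an eigenspace of \<open>X\<close>.\<close>

section \<open>Complex inner products\<close>

instance chilbert_space \<subseteq> banach ..

lemma cinner_add_left: "cinner (x + y) z = cinner x z + cinner y z"
  by (metis cinner_add_right cinner_commute complex_cnj_add)

lemma cinner_scaleC_left: "cinner (a *\<^sub>C x) y = cnj a * cinner x y"
  by (metis cinner_commute cinner_scaleC_right complex_cnj_mult)

lemma cinner_scaleR_right: "cinner x (r *\<^sub>R y) = r *\<^sub>R cinner x y"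
  by (simp add: scaleR_scaleC cinner_scaleC_right scaleR_conv_of_real)

lemma cinner_scaleR_left: "cinner (r *\<^sub>R x) y = r *\<^sub>R cinner x y"
  by (simp add: scaleR_scaleC cinner_scaleC_left scaleR_conv_of_real)

lemma cinner_self: "cinner x x = complex_of_real ((norm x)\<^sup>2)"
proof -
  have "Im (cinner x x) = 0"
    using cinner_commute[of x x] by (metis Reals_cnj_iff complex_is_Real_iff)
  then show ?thesis
    by (simp add: complex_eq_iff inner_eq_Re_cinner[symmetric] power2_norm_eq_inner)
qed

lemma norm_scaleC: "norm (a *\<^sub>C x) = cmod a * norm x"
proof -
  have "complex_of_real ((norm (a *\<^sub>C x))\<^sup>2) = complex_of_real ((cmod a * norm x)\<^sup>2)"
    unfolding cinner_self[symmetric] cinner_scaleC_left cinner_scaleC_right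
    by (simp add: cinner_self power_mult_distrib complex_norm_square[of a, simplified] mult_ac)
  then have "(norm (a *\<^sub>C x))\<^sup>2 = (cmod a * norm x)\<^sup>2"
    using of_real_eq_iff by blast
  then show ?thesis by (simp add: power2_eq_iff_nonneg)
qed

text \<open>The real Cauchy-Schwarz inequality for \<open>\<bullet>\<close> suffices once
  \<open>y\<close> is multiplied by the unit phase \<open>a\<close> that makes
  \<open>cinner x y\<close> real and nonnegative.\<close>

lemma norm_cinner_le: "cmod (cinner x y) \<le> norm x * norm y"
proof (cases "cinner x y = 0")
  case False
  define a where "a = cnj (sgn (cinner x y))"
  have n: "cmod a = 1" using False by (simp add: a_def norm_sgn)
  have "cmod (cinner x y) = Re (cinner x (a *\<^sub>C y))"
  proof -
    have "cnj (cinner x y) * cinner x y = complex_of_real ((cmod (cinner x y))\<^sup>2)"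
      by (simp add: complex_norm_square[of "cinner x y", simplified] mult.commute)
    then show ?thesis
      using False by (simp add: a_def cinner_scaleC_right sgn_eq power2_eq_square)
  qed
  also have "\<dots> = x \<bullet> (a *\<^sub>C y)" by (simp add: inner_eq_Re_cinner)
  also have "\<dots> \<le> norm x * norm (a *\<^sub>C y)" by (rule norm_cauchy_schwarz)
  finally show ?thesis by (simp add: norm_scaleC n)
qed simp

lemma bounded_bilinear_cinner: "bounded_bilinear cinner"
proof
  show "\<exists>K. \<forall>a b. norm (cinner a b) \<le> norm a * norm b * K"
    using norm_cinner_le by (metis mult.right_neutral)
qed (auto simp: cinner_add_left cinner_add_right cinner_scaleR_left cinner_scaleR_right)

lemma bounded_bilinear_scaleC: "bounded_bilinear (*\<^sub>C)"
proof
  show "\<exists>K. \<forall>a b. norm (a *\<^sub>C b) \<le> norm a * norm b * K"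
    by (metis norm_scaleC mult.right_neutral order_refl)
next
  fix r a and b :: 'a
  show "(r *\<^sub>R a) *\<^sub>C b = r *\<^sub>R (a *\<^sub>C b)"
    by (simp add: scaleR_scaleC scaleC_scaleC scaleR_conv_of_real)
  show "a *\<^sub>C r *\<^sub>R b = r *\<^sub>R (a *\<^sub>C b)"
    by (simp add: scaleR_scaleC scaleC_scaleC mult.commute)
qed (auto simp: scaleC_add_left scaleC_add_right)

lemmas bounded_linear_cinner_right = bounded_bilinear.bounded_linear_right[OF bounded_bilinear_cinner]
lemmas tendsto_cinner = bounded_bilinear.tendsto[OF bounded_bilinear_cinner]
lemmas continuous_on_cinner = bounded_bilinear.continuous_on[OF bounded_bilinear_cinner]
lemmas continuous_on_scaleC = bounded_bilinear.continuous_on[OF bounded_bilinear_scaleC]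
lemmas cinner_sum_left = bounded_bilinear.sum_left[OF bounded_bilinear_cinner]
lemmas cinner_sum_right = bounded_bilinear.sum_right[OF bounded_bilinear_cinner]
lemmas cinner_diff_left = bounded_bilinear.diff_left[OF bounded_bilinear_cinner]
lemmas cinner_diff_right = bounded_bilinear.diff_right[OF bounded_bilinear_cinner]
lemmas cinner_zero_right = bounded_bilinear.zero_right[OF bounded_bilinear_cinner]
lemmas scaleC_zero_left = bounded_bilinear.zero_left[OF bounded_bilinear_scaleC]
lemmas scaleC_diff_left = bounded_bilinear.diff_left[OF bounded_bilinear_scaleC]

section \<open>Symmetric operators\<close>

text \<open>For \<open>M\<close> the supremum of the quadratic form, \<open>B = M - T\<close> is nonnegative and bounded by some \<open>c\<close>,
  and expanding \<open>0 \<le> \<langle>x - sBx, B(x - sBx)\<rangle>\<close> with \<open>s = 1/c\<close> gives \<open>|Bx|\<^sup>2 \<le> c \<langle>x, Bx\<rangle>\<close>.  So every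
  maximizing sequence consists of approximate eigenvectors.\<close>

lemma approximate_eigenvectors:
  fixes T :: "'a::real_inner \<Rightarrow> 'a"
  assumes E: "subspace E" "x0 \<in> E" "x0 \<noteq> 0"
    and maps: "\<And>x. x \<in> E \<Longrightarrow> T x \<in> E"
    and add: "\<And>x y. x \<in> E \<Longrightarrow> y \<in> E \<Longrightarrow> T (x + y) = T x + T y"
    and scale: "\<And>r x. x \<in> E \<Longrightarrow> T (r *\<^sub>R x) = r *\<^sub>R T x"
    and sym: "\<And>x y. x \<in> E \<Longrightarrow> y \<in> E \<Longrightarrow> x \<bullet> T y = T x \<bullet> y"
    and bound: "\<And>x. x \<in> E \<Longrightarrow> norm (T x) \<le> K * norm x"
  obtains M x where "\<And>n. x n \<in> E" "\<And>n::nat. norm (x n) = 1" "(\<lambda>n. T (x n) - M *\<^sub>R x n) \<longlonglongrightarrow> 0"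
    "\<And>y. y \<in> E \<Longrightarrow> y \<bullet> T y \<le> M * (norm y)\<^sup>2"
proof -
  define S where "S = (\<lambda>x. x \<bullet> T x) ` {x \<in> E. norm x = 1}"
  define M where "M = Sup S"
  have ne: "S \<noteq> {}"
    using E subspace_scale[OF E(1,2), of "1 / norm x0"]
    by (auto simp: S_def intro!: exI[of _ "(1 / norm x0) *\<^sub>R x0"])
  have le: "x \<bullet> T x \<le> K" if "x \<in> E" "norm x = 1" for x
    using norm_cauchy_schwarz[of x "T x"] bound[OF that(1)] that by simp
  then have bdd: "bdd_above S" by (auto simp: S_def bdd_above_def)
  have M1: "x \<bullet> T x \<le> M" if "x \<in> E" "norm x = 1" for x
    unfolding M_def by (rule cSup_upper[OF _ bdd]) (use that in \<open>auto simp: S_def\<close>)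
  have M: "y \<bullet> T y \<le> M * (norm y)\<^sup>2" if "y \<in> E" for y
  proof (cases "y = 0")
    case False
    have "((1 / norm y) *\<^sub>R y) \<bullet> T ((1 / norm y) *\<^sub>R y) \<le> M"
      by (rule M1) (use that False E in \<open>auto intro: subspace_scale\<close>)
    then show ?thesis using that False by (simp add: scale divide_simps power2_eq_square)
  qed simp
  have "\<exists>x. x \<in> E \<and> norm x = 1 \<and> M - 1 / Suc n < x \<bullet> T x" for n
  proof -
    have "M - 1 / Suc n < Sup S" by (simp add: M_def)
    from less_cSupD[OF ne this] show ?thesis by (auto simp: S_def)
  qed
  then obtain x where x: "x n \<in> E" "norm (x n) = 1" "M - 1 / Suc n < x n \<bullet> T (x n)" for n
    by metis
  define B where "B y = M *\<^sub>R y - T y" for y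
  \<comment> \<open>The summand 1 keeps \<open>c\<close> positive, so that dividing by it below is
    legitimate.\<close>
  define c where "c = \<bar>M\<bar> + \<bar>K\<bar> + 1"
  have c: "c > 0" by (simp add: c_def)
  have BE: "B y \<in> E" if "y \<in> E" for y
    using that maps E(1) by (auto simp: B_def intro: subspace_diff subspace_scale)
  have Bsym: "y \<bullet> B z = B y \<bullet> z" if "y \<in> E" "z \<in> E" for y z
    using sym[OF that] by (simp add: B_def inner_diff_left inner_diff_right)
  have Bdiff: "B (y - s *\<^sub>R z) = B y - s *\<^sub>R B z" if "y \<in> E" "z \<in> E" for y z s
    using that add[of y "(-s) *\<^sub>R z"] scale[of z "-s"] E(1)
    by (simp add: B_def algebra_simps subspace_scale subspace_neg)
  have Bpos: "0 \<le> y \<bullet> B y" if "y \<in> E" for y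
    using M[OF that] by (simp add: B_def inner_diff_right power2_norm_eq_inner)
  have Bc: "y \<bullet> B y \<le> c * (norm y)\<^sup>2" if "y \<in> E" for y
  proof -
    have "norm (B y) \<le> \<bar>M\<bar> * norm y + K * norm y"
      using norm_triangle_ineq4[of "M *\<^sub>R y" "T y"] bound[OF that] by (simp add: B_def)
    also have "\<dots> \<le> c * norm y"
      unfolding c_def distrib_right by (smt (verit) mult_right_mono norm_ge_zero mult_1)
    finally have "norm y * norm (B y) \<le> norm y * (c * norm y)" by (rule mult_left_mono) simp
    then show ?thesis
      using norm_cauchy_schwarz[of y "B y"] by (simp add: power2_eq_square algebra_simps)
  qed
  have key: "(norm (B y))\<^sup>2 \<le> c * (y \<bullet> B y)" if "y \<in> E" for y
  proof -
    define s where "s = 1 / c"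
    have "y - s *\<^sub>R B y \<in> E" using that BE E(1) by (auto intro: subspace_diff subspace_scale)
    from Bpos[OF this] have "0 \<le> y \<bullet> B y - 2 * s * (norm (B y))\<^sup>2 + s\<^sup>2 * (B y \<bullet> B (B y))"
      using that BE Bsym[OF that BE[OF that]]
      by (simp add: Bdiff inner_diff_left inner_diff_right power2_norm_eq_inner algebra_simps power2_eq_square[of s])
    also have "\<dots> \<le> y \<bullet> B y - 2 * s * (norm (B y))\<^sup>2 + s\<^sup>2 * (c * (norm (B y))\<^sup>2)"
      using mult_left_mono[OF Bc[OF BE[OF that]], of "s\<^sup>2"] by simp
    also have "s\<^sup>2 * (c * (norm (B y))\<^sup>2) = s * (norm (B y))\<^sup>2"
      using c by (simp add: s_def power2_eq_square)
    finally show ?thesis using c by (simp add: s_def field_simps)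
  qed
  have lim: "(\<lambda>n. c * (1 / Suc n)) \<longlonglongrightarrow> 0"
    by (intro tendsto_mult_right_zero LIMSEQ_Suc[OF lim_const_over_n[of 1]])
  have "(\<lambda>n. (norm (B (x n)))\<^sup>2) \<longlonglongrightarrow> 0"
  proof (rule tendsto_sandwich[OF _ _ tendsto_const lim])
    show "\<forall>\<^sub>F n in sequentially. (norm (B (x n)))\<^sup>2 \<le> c * (1 / Suc n)"
    proof (intro always_eventually allI)
      fix n
      have "x n \<bullet> B (x n) \<le> 1 / Suc n"
        using x[of n] by (simp add: B_def inner_diff_right power2_norm_eq_inner[symmetric])
      from mult_left_mono[OF this, of c] show "(norm (B (x n)))\<^sup>2 \<le> c * (1 / Suc n)"
        using key[OF x(1)[of n]] c by linarith
    qed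
  qed auto
  then have "(\<lambda>n. - B (x n)) \<longlonglongrightarrow> - 0"
    by (intro tendsto_minus) (auto simp: tendsto_norm_zero_iff intro!: tendsto_norm_zero_cancel[of "\<lambda>n. B (x n)"]
        dest: tendsto_real_sqrt)
  then have "(\<lambda>n. T (x n) - M *\<^sub>R x n) \<longlonglongrightarrow> 0" by (simp add: B_def)
  with x M that show thesis by blast
qed

(* keeps the order 1 of a Sobolev space from being rewritten to Suc 0 *)
declare One_nat_def [simp del]

section \<open>Expansion in eigenvectors\<close>

locale eigenbasis =
  fixes lam :: "nat \<Rightarrow> real" and e :: "nat \<Rightarrow> 'h::chilbert_space"
  assumes lam_0_pos: "0 < lam 0" and mono_lam: "mono lam"
    and lam_at_top: "filterlim lam at_top sequentially"
    and basis: "orthonormal_basis e"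
begin

lemma lam_pos: "0 < lam j"
  using lam_0_pos monoD[OF mono_lam, of 0 j] by simp

lemma cinner_e: "cinner (e i) (e j) = (if i = j then 1 else 0)"
  using basis by (simp add: orthonormal_basis_def)

lemma norm_e: "norm (e j) = 1"
proof -
  have "complex_of_real ((norm (e j))\<^sup>2) = complex_of_real 1"
    unfolding cinner_self[symmetric] by (simp add: cinner_e)
  then have "(norm (e j))\<^sup>2 = 1" using of_real_eq_iff by blast
  then show ?thesis using norm_ge_zero[of "e j"] unfolding power2_eq_1_iff by linarith
qed

section \<open>Truncated expansions and their norms\<close>

definition proj :: "nat \<Rightarrow> 'h \<Rightarrow> 'h" where
  "proj N x = (\<Sum>j<N. cinner (e j) x *\<^sub>C e j)"

text \<open>A truncation of the quadratic form of \<Gamma>, i.e. of the squared H^1 norm. Unlike the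
  full series it is finite and continuous on all of H, so it can be integrated in time and passed to
  limits.\<close>

definition energy :: "nat \<Rightarrow> 'h \<Rightarrow> real" where
  "energy N x = (\<Sum>j<N. lam j * (cmod (cinner (e j) x))\<^sup>2)"

lemma proj_tendsto: "(\<lambda>N. proj N x) \<longlonglongrightarrow> x"
proof -
  obtain c where c: "(\<lambda>j. c j *\<^sub>C e j) sums x"
    using basis unfolding orthonormal_basis_def by blast
  \<comment> \<open>The basis property only provides some expansion; continuity of the inner product
    and orthonormality identify its coefficients.\<close>
  have "cinner (e k) x = c k" for k
  proof -
    have "(\<lambda>j. cinner (e k) (c j *\<^sub>C e j)) sums cinner (e k) x"
      by (rule bounded_linear.sums[OF bounded_linear_cinner_right c])
    then have "(\<lambda>j. if j = k then c j else 0) sums cinner (e k) x"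
      by (simp add: cinner_scaleC_right cinner_e if_distrib eq_commute cong: if_cong)
    then show ?thesis
      using sums_single[of k c] sums_unique2 by blast
  qed
  then show ?thesis using c by (simp add: sums_def proj_def)
qed

lemma cinner_proj_left: "cinner (proj N x) y = (\<Sum>j<N. cnj (cinner (e j) x) * cinner (e j) y)"
  by (simp add: proj_def cinner_sum_left cinner_scaleC_left)

lemma cinner_proj_right: "cinner y (proj N x) = (\<Sum>j<N. cinner (e j) x * cinner y (e j))"
  by (simp add: proj_def cinner_sum_right cinner_scaleC_right)

lemma cinner_e_proj: "cinner (e k) (proj N x) = (if k < N then cinner (e k) x else 0)"
  by (simp add: cinner_proj_right cinner_e if_distrib cong: if_cong)

lemma norm_proj: "(norm (proj N x))\<^sup>2 = (\<Sum>j<N. (cmod (cinner (e j) x))\<^sup>2)"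
proof -
  have "complex_of_real ((norm (proj N x))\<^sup>2) = (\<Sum>j<N. cnj (cinner (e j) x) * cinner (e j) x)"
    unfolding cinner_self[symmetric] cinner_proj_left
    by (intro sum.cong refl) (simp add: cinner_e_proj)
  also have "\<dots> = complex_of_real (\<Sum>j<N. (cmod (cinner (e j) x))\<^sup>2)"
    by (simp add: complex_norm_square[simplified] mult.commute)
  finally show ?thesis using of_real_eq_iff by blast
qed

lemma norm_proj_tendsto: "(\<lambda>N. (norm (proj N x))\<^sup>2) \<longlonglongrightarrow> (norm x)\<^sup>2"
  by (intro tendsto_intros proj_tendsto)

lemma norm_proj_mono: "M \<le> N \<Longrightarrow> (norm (proj M x))\<^sup>2 \<le> (norm (proj N x))\<^sup>2"
  unfolding norm_proj by (rule sum_mono2) auto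

lemma norm_proj_le: "norm (proj N x) \<le> norm x"
proof -
  have "(norm (proj N x))\<^sup>2 \<le> (norm x)\<^sup>2"
    by (rule incseq_le[OF _ norm_proj_tendsto]) (unfold incseq_def, blast intro: norm_proj_mono)
  then show ?thesis by (simp add: power2_le_iff_abs_le)
qed

lemma proj_diff: "proj N (x - y) = proj N x - proj N y"
  by (simp add: proj_def cinner_diff_right scaleC_diff_left sum_subtractf)

lemma eq_if_coeffs_eq:
  assumes "\<And>j. cinner (e j) x = cinner (e j) y"
  shows "x = y"
proof -
  have "proj N x = proj N y" for N using assms by (simp add: proj_def)
  then have "(\<lambda>N. proj N x) \<longlonglongrightarrow> y" by (simp add: proj_tendsto)
  then show ?thesis using proj_tendsto LIMSEQ_unique by blast
qed

section \<open>Partial energies and tail estimates\<close>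

lemma energy_nonneg: "0 \<le> energy N x"
  unfolding energy_def by (intro sum_nonneg mult_nonneg_nonneg) (auto simp: less_imp_le lam_pos)

lemma energy_mono: "M \<le> N \<Longrightarrow> energy M x \<le> energy N x"
  unfolding energy_def
  by (rule sum_mono2) (auto intro!: mult_nonneg_nonneg simp: less_imp_le lam_pos)

lemma energy_scaleC: "energy N (a *\<^sub>C x) = (cmod a)\<^sup>2 * energy N x"
  by (simp add: energy_def cinner_scaleC_right norm_mult power_mult_distrib sum_distrib_left mult_ac)

lemma energy_scaleR: "energy N (r *\<^sub>R x) = r\<^sup>2 * energy N x"
  by (simp add: scaleR_scaleC energy_scaleC)

lemma energy_add_le: "energy N (x + y) \<le> 2 * energy N x + 2 * energy N y"
proof -
  have "energy N (x + y) \<le> (\<Sum>j<N. 2 * (lam j * (cmod (cinner (e j) x))\<^sup>2) + 2 * (lam j * (cmod (cinner (e j) y))\<^sup>2))"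
    unfolding energy_def
  proof (rule sum_mono)
    fix j
    let ?a = "cinner (e j) x" and ?b = "cinner (e j) y"
    have "(cmod (?a + ?b))\<^sup>2 \<le> (cmod ?a + cmod ?b)\<^sup>2"
      by (intro power_mono norm_triangle_ineq) auto
    also have "\<dots> \<le> 2 * (cmod ?a)\<^sup>2 + 2 * (cmod ?b)\<^sup>2"
      using zero_le_power2[of "cmod ?a - cmod ?b"] unfolding power2_sum power2_diff by linarith
    finally have "lam j * (cmod (?a + ?b))\<^sup>2 \<le> lam j * (2 * (cmod ?a)\<^sup>2 + 2 * (cmod ?b)\<^sup>2)"
      by (rule mult_left_mono) (simp add: less_imp_le lam_pos)
    then show "lam j * (cmod (cinner (e j) (x + y)))\<^sup>2
        \<le> 2 * (lam j * (cmod ?a)\<^sup>2) + 2 * (lam j * (cmod ?b)\<^sup>2)"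
      by (simp add: cinner_add_right algebra_simps)
  qed
  then show ?thesis by (simp add: energy_def sum.distrib sum_distrib_left)
qed

lemma energy_diff_le: "energy N (x - y) \<le> 2 * energy N x + 2 * energy N y"
  using energy_add_le[of N x "(-1) *\<^sub>R y"] energy_scaleR[of N "-1" y] by simp

text \<open>Coefficients with index at least \<open>N\<close> carry weight at least
  \<open>lam N\<close> in the energy, so their squares sum to at most \<open>R / lam N\<close>. As
  \<open>lam\<close> tends to infinity, tails are uniformly small on sets of bounded energy.\<close>

lemma norm_proj_tail:
  assumes "energy M x \<le> R"
  shows "(norm (proj M x))\<^sup>2 \<le> (norm (proj N x))\<^sup>2 + R / lam N"
proof -
  have R: "0 \<le> R" using assms energy_nonneg order_trans by blast
  show ?thesis
  proof (cases "M \<le> N")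
    case True
    then show ?thesis
      using norm_proj_mono[OF True, of x] R lam_pos[of N] by (simp add: add_increasing2)
  next
    case False
    let ?f = "\<lambda>j. (cmod (cinner (e j) x))\<^sup>2"
    have split: "{..<M} = {..<N} \<union> {N..<M}" using False by auto
    have "lam N * (\<Sum>j=N..<M. ?f j) \<le> (\<Sum>j=N..<M. lam j * ?f j)"
      unfolding sum_distrib_left by (intro sum_mono mult_right_mono monoD[OF mono_lam]) auto
    also have "\<dots> \<le> energy M x"
      unfolding energy_def
      by (rule sum_mono2) (auto intro!: mult_nonneg_nonneg simp: less_imp_le lam_pos)
    finally have "(\<Sum>j=N..<M. ?f j) \<le> R / lam N"
      using assms lam_pos[of N] by (simp add: field_simps)
    moreover have "(norm (proj M x))\<^sup>2 = (norm (proj N x))\<^sup>2 + (\<Sum>j=N..<M. ?f j)"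
      unfolding norm_proj split by (rule sum.union_disjoint) auto
    ultimately show ?thesis by simp
  qed
qed

lemma norm_tail:
  assumes "\<And>M. energy M x \<le> R"
  shows "(norm x)\<^sup>2 \<le> (norm (proj N x))\<^sup>2 + R / lam N"
  by (rule LIMSEQ_le_const2[OF norm_proj_tendsto]) (use norm_proj_tail[OF assms] in blast)

section \<open>The first Sobolev space in terms of partial energies\<close>

lemma sobolev_iff: "x \<in> sobolev lam e 1 \<longleftrightarrow> summable (\<lambda>j. lam j * (cmod (cinner (e j) x))\<^sup>2)"
  by (simp add: sobolev_def sobolev_coeffs_def coeffs_def)

lemma sobolev_norm_sq:
  "x \<in> sobolev lam e 1 \<Longrightarrow> (sobolev_norm lam e 1 x)\<^sup>2 = (\<Sum>j. lam j * (cmod (cinner (e j) x))\<^sup>2)"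
  unfolding sobolev_iff sobolev_norm_def sobolev_coeffs_norm_def coeffs_def
  by (simp add: suminf_nonneg lam_pos less_imp_le)

lemma sobolev_norm_nonneg: "x \<in> sobolev lam e 1 \<Longrightarrow> 0 \<le> sobolev_norm lam e 1 x"
  unfolding sobolev_iff sobolev_norm_def sobolev_coeffs_norm_def coeffs_def
  by (simp add: suminf_nonneg lam_pos less_imp_le)

lemma energy_le_sobolev_norm:
  "x \<in> sobolev lam e 1 \<Longrightarrow> energy N x \<le> (sobolev_norm lam e 1 x)\<^sup>2"
  unfolding energy_def
  by (subst sobolev_norm_sq, assumption, rule sum_le_suminf) (auto simp: sobolev_iff less_imp_le lam_pos)

text \<open>Converse of \<open>energy_le_sobolev_norm\<close>: a nonnegative series with bounded
  partial sums converges. Both facts together translate H^1 bounds into uniform bounds on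
  \<open>energy\<close>.\<close>

lemma
  assumes "\<And>N. energy N x \<le> R"
  shows sobolev_if_energy_le: "x \<in> sobolev lam e 1"
    and sobolev_norm_if_energy_le: "(sobolev_norm lam e 1 x)\<^sup>2 \<le> R"
proof -
  show s: "x \<in> sobolev lam e 1" unfolding sobolev_iff
    by (rule bounded_imp_summable[of _ R])
      (use assms[unfolded energy_def] in \<open>auto simp: less_imp_le lam_pos simp del: sum.lessThan_Suc simp flip: lessThan_Suc_atMost\<close>)
  show "(sobolev_norm lam e 1 x)\<^sup>2 \<le> R"
    unfolding sobolev_norm_sq[OF s]
    by (rule suminf_le_const) (use s assms in \<open>auto simp: sobolev_iff energy_def\<close>)
qed

lemma sobolev_scaleC: "x \<in> sobolev lam e 1 \<Longrightarrow> a *\<^sub>C x \<in> sobolev lam e 1"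
  by (rule sobolev_if_energy_le[of _ "(cmod a)\<^sup>2 * (sobolev_norm lam e 1 x)\<^sup>2"])
    (simp add: energy_scaleC energy_le_sobolev_norm mult_left_mono)

lemma sobolev_add:
  assumes "x \<in> sobolev lam e 1" "y \<in> sobolev lam e 1"
  shows "x + y \<in> sobolev lam e 1"
  by (rule sobolev_if_energy_le[of _ "2 * (sobolev_norm lam e 1 x)\<^sup>2 + 2 * (sobolev_norm lam e 1 y)\<^sup>2"])
    (use energy_add_le[of _ x y] energy_le_sobolev_norm[OF assms(1)] energy_le_sobolev_norm[OF assms(2)]
     in \<open>smt (verit)\<close>)

lemma e_in_sobolev: "e k \<in> sobolev lam e 1"
proof (rule sobolev_if_energy_le[of _ "lam k"])
  fix N
  show "energy N (e k) \<le> lam k"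
  proof -
    have "energy N (e k) = (\<Sum>j<N. if j = k then lam j else 0)"
      unfolding energy_def by (intro sum.cong) (auto simp: cinner_e)
    then show ?thesis using lam_pos[of k] by simp
  qed
qed

lemma proj_in_sobolev: "proj N x \<in> sobolev lam e 1"
proof (induction N)
  case 0
  then show ?case by (simp add: proj_def sobolev_iff cinner_zero_right)
next
  case (Suc N)
  then show ?case
    using sobolev_add[OF Suc sobolev_scaleC[OF e_in_sobolev]] by (simp add: proj_def)
qed

text \<open>In H^1 the squared distance from \<open>x\<close> to \<open>proj N x\<close> is a tail
  of the convergent series for the squared norm of \<open>x\<close>.\<close>

lemma sobolev_proj_tendsto:
  assumes "x \<in> sobolev lam e 1"
  shows "(\<lambda>N. sobolev_norm lam e 1 (x - proj N x)) \<longlonglongrightarrow> 0"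
proof -
  let ?f = "\<lambda>j. lam j * (cmod (cinner (e j) x))\<^sup>2"
  let ?s = "(sobolev_norm lam e 1 x)\<^sup>2"
  have "?f sums ?s"
    using assms by (simp add: sobolev_norm_sq sobolev_iff summable_sums)
  then have lim: "(\<lambda>N. energy N x) \<longlonglongrightarrow> ?s" by (simp add: sums_def energy_def)
  have le: "(sobolev_norm lam e 1 (x - proj N x))\<^sup>2 \<le> ?s - energy N x" for N
  proof (rule sobolev_norm_if_energy_le)
    fix M
    \<comment> \<open>Passing to \<open>max M N\<close> makes the truncation reach at least to
      \<open>N\<close>, so that subtracting \<open>proj N x\<close> removes exactly
      \<open>energy N x\<close>.\<close>
    have "energy M (x - proj N x) \<le> energy (max M N) (x - proj N x)" by (rule energy_mono) simp
    also have "\<dots> = energy (max M N) x - energy N x"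
    proof -
      have split: "{..<max M N} = {..<N} \<union> {N..<max M N}" by auto
      have a: "energy (max M N) y = energy N y + (\<Sum>j=N..<max M N. lam j * (cmod (cinner (e j) y))\<^sup>2)" for y
        unfolding energy_def split by (rule sum.union_disjoint) auto
      have "energy N (x - proj N x) = 0"
        by (simp add: energy_def cinner_diff_right cinner_e_proj)
      moreover have "(\<Sum>j=N..<max M N. lam j * (cmod (cinner (e j) (x - proj N x)))\<^sup>2)
          = (\<Sum>j=N..<max M N. lam j * (cmod (cinner (e j) x))\<^sup>2)"
        by (intro sum.cong) (auto simp: cinner_diff_right cinner_e_proj)
      ultimately show ?thesis using a[of x] a[of "x - proj N x"] by simp
    qed
    also have "\<dots> \<le> ?s - energy N x" using energy_le_sobolev_norm[OF assms] by simp
    finally show "energy M (x - proj N x) \<le> ?s - energy N x" .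
  qed
  have "(\<lambda>N. (sobolev_norm lam e 1 (x - proj N x))\<^sup>2) \<longlonglongrightarrow> 0"
    by (rule tendsto_sandwich[of "\<lambda>_. 0" _ _ "\<lambda>N. ?s - energy N x"])
      (use le tendsto_diff[OF tendsto_const lim, of ?s] in auto)
  from tendsto_real_sqrt[OF this] show ?thesis by (simp add: tendsto_rabs_zero_iff)
qed

section \<open>Compactness of sets of bounded energy\<close>

lemma energy_tendsto_le:
  assumes "x \<longlonglongrightarrow> y" "\<And>n. energy N (x n) \<le> R"
  shows "energy N y \<le> R"
proof -
  have "(\<lambda>n. energy N (x n)) \<longlonglongrightarrow> energy N y"
    unfolding energy_def by (intro tendsto_intros tendsto_cinner assms(1))
  then show ?thesis using assms(2) by (intro LIMSEQ_le_const2) auto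
qed

text \<open>Bounded energy makes the tails uniformly small, so only finitely many coefficients
  matter for the Cauchy property in norm.\<close>

lemma convergent_if_coeffs_convergent:
  assumes conv: "\<And>j. convergent (\<lambda>n. cinner (e j) (x n))"
    and R: "\<And>n N. energy N (x n) \<le> R"
  shows "convergent x"
proof -
  have "Cauchy x"
  proof (rule metric_CauchyI)
    fix \<epsilon> :: real assume \<epsilon>: "\<epsilon> > 0"
    \<comment> \<open>Differences have energy at most \<open>4 * R\<close>, so this \<open>N\<close>
      keeps their squared tails below \<open>\<epsilon>\<^sup>2 / 2\<close>; the first
      \<open>N\<close> coefficients will contribute at most
      \<open>\<epsilon>\<^sup>2 / 4\<close>.\<close>
    have "\<forall>\<^sub>F N in sequentially. lam N > 8 * \<bar>R\<bar> / \<epsilon>\<^sup>2 + 1"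
      using lam_at_top by (simp add: filterlim_at_top_dense)
    then obtain N where N: "lam N > 8 * \<bar>R\<bar> / \<epsilon>\<^sup>2 + 1" by (auto simp: eventually_sequentially)
    then have tail: "4 * R / lam N < \<epsilon>\<^sup>2 / 2"
    proof -
      have "8 * R / \<epsilon>\<^sup>2 < lam N" using N \<epsilon> by (smt (verit) divide_right_mono zero_le_power2)
      then show ?thesis using \<epsilon> lam_pos[of N] by (simp add: field_simps)
    qed
    have "Cauchy (\<lambda>n. proj N (x n))"
    proof (rule convergent_Cauchy)
      from conv obtain l where l: "\<And>j. (\<lambda>n. cinner (e j) (x n)) \<longlonglongrightarrow> l j"
        unfolding convergent_def by metis
      have "(\<lambda>n. proj N (x n)) \<longlonglongrightarrow> (\<Sum>j<N. l j *\<^sub>C e j)"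
        unfolding proj_def
        by (intro tendsto_sum bounded_bilinear.tendsto[OF bounded_bilinear_scaleC] l tendsto_const)
      then show "convergent (\<lambda>n. proj N (x n))" by (auto simp: convergent_def)
    qed
    from metric_CauchyD[OF this, of "\<epsilon> / 2"] \<epsilon> obtain K where
      K: "\<And>m n. m \<ge> K \<Longrightarrow> n \<ge> K \<Longrightarrow> dist (proj N (x m)) (proj N (x n)) < \<epsilon> / 2" by auto
    show "\<exists>K. \<forall>m\<ge>K. \<forall>n\<ge>K. dist (x m) (x n) < \<epsilon>"
    proof (intro exI allI impI)
      fix m n assume mn: "m \<ge> K" "n \<ge> K"
      have "(norm (x m - x n))\<^sup>2 \<le> (norm (proj N (x m - x n)))\<^sup>2 + 4 * R / lam N"
        by (rule norm_tail) (use energy_diff_le[of _ "x m" "x n"] R in \<open>smt (verit)\<close>)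
      also have "\<dots> \<le> (\<epsilon> / 2)\<^sup>2 + 4 * R / lam N"
        using K[OF mn] by (intro add_right_mono power_mono) (auto simp: proj_diff dist_norm)
      also have "\<dots> = \<epsilon>\<^sup>2 / 4 + 4 * R / lam N" by (simp add: power_divide)
      also have "\<dots> < \<epsilon>\<^sup>2" using tail zero_less_power[OF \<epsilon>, of 2] by linarith
      finally have "(norm (x m - x n))\<^sup>2 < \<epsilon>\<^sup>2" .
      then show "dist (x m) (x n) < \<epsilon>"
        using \<epsilon> by (simp add: dist_norm power2_less_imp_less)
    qed
  qed
  then show ?thesis by (rule Cauchy_convergent)
qed

text \<open>Compactness of the embedding of H^1 into H: a diagonal argument makes every coefficient
  converge along one subsequence, and the energy bound upgrades this to norm convergence.\<close>

lemma convergent_subsequence: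
  assumes K: "\<And>n. norm (x n) \<le> K" and R: "\<And>n N. energy N (x n) \<le> R"
  obtains r y where "strict_mono (r::nat \<Rightarrow> nat)" "(\<lambda>n. x (r n)) \<longlonglongrightarrow> y"
proof -
  have le: "cmod (cinner (e j) (x n)) \<le> K" for n j
    using norm_cinner_le[of "e j" "x n"] K[of n] by (simp add: norm_e)
  obtain r :: "nat \<Rightarrow> nat" where r: "strict_mono r"
    "\<And>j. j \<in> UNIV \<Longrightarrow> \<exists>l. (\<lambda>n. cinner (e j) (x (r n))) \<longlonglongrightarrow> l"
    by (rule function_convergent_subsequence[of UNIV "\<lambda>n j. cinner (e j) (x n)" K])
      (use le in \<open>simp_all\<close>)
  have "convergent (\<lambda>n. x (r n))"
    by (rule convergent_if_coeffs_convergent) (use r R in \<open>auto simp: convergent_def\<close>)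
  with r(1) that show thesis by (auto simp: convergent_def)
qed

end

section \<open>Operators bounded relative to the first Sobolev norm\<close>

locale relatively_bounded = eigenbasis lam e
  for lam and e :: "nat \<Rightarrow> 'h::chilbert_space" +
  fixes D :: "'h set" and L :: "'h \<Rightarrow> 'h" and C :: real
  assumes linear_L: "csubspace D" "clinear_on D L"
    and symmetric_L: "\<And>x y. x \<in> D \<Longrightarrow> y \<in> D \<Longrightarrow> cinner (L x) y = cinner x (L y)"
    and sobolev_D: "\<And>x. x \<in> sobolev lam e 1 \<Longrightarrow> x \<in> D"
    and norm_L_le: "\<And>x. x \<in> sobolev lam e 1 \<Longrightarrow> norm (L x) \<le> C * sobolev_norm lam e 1 x"
begin

lemma L_add: "x \<in> D \<Longrightarrow> y \<in> D \<Longrightarrow> L (x + y) = L x + L y"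
  using linear_L by (simp add: clinear_on_def)

lemma L_scaleC: "x \<in> D \<Longrightarrow> L (a *\<^sub>C x) = a *\<^sub>C L x"
  using linear_L by (simp add: clinear_on_def)

lemma L_scaleR: "x \<in> D \<Longrightarrow> L (r *\<^sub>R x) = r *\<^sub>R L x"
  by (simp add: scaleR_scaleC L_scaleC)

lemma D_scaleC: "x \<in> D \<Longrightarrow> a *\<^sub>C x \<in> D"
  using linear_L by (simp add: csubspace_def)

lemma L_diff:
  assumes "x \<in> D" "y \<in> D"
  shows "L (x - y) = L x - L y"
proof -
  have "(-1) *\<^sub>C z = - z" for z :: 'h
    using scaleR_scaleC[of "-1" z] by simp
  then show ?thesis
    using L_add[OF assms(1) D_scaleC[OF assms(2), of "-1"]] L_scaleC[OF assms(2), of "-1"] by simp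
qed

lemma Im_cinner_L: "x \<in> D \<Longrightarrow> Im (cinner x (L x)) = 0"
  using symmetric_L[of x x] cinner_commute[of x "L x"]
  by (metis Reals_cnj_iff complex_is_Real_iff)

lemma e_in_D: "e k \<in> D"
  by (simp add: e_in_sobolev sobolev_D)

lemma L_proj: "L (proj N x) = (\<Sum>j<N. cinner (e j) x *\<^sub>C L (e j))"
proof (induction N)
  case 0
  then show ?case
    using L_scaleC[OF e_in_D[of 0], of 0] by (simp add: proj_def scaleC_zero_left)
next
  case (Suc N)
  have "proj (Suc N) x = proj N x + cinner (e N) x *\<^sub>C e N" by (simp add: proj_def)
  then show ?case
    using L_add[OF sobolev_D[OF proj_in_sobolev] D_scaleC[OF e_in_D]] Suc
    by (simp add: L_scaleC e_in_D)
qed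

text \<open>\<open>proj N x\<close> tends to \<open>x\<close> in the H^1 norm, and \<open>L\<close>
  is bounded from H^1 to H. This justifies replacing \<open>L x\<close> by finite combinations of
  the \<open>L (e j)\<close>.\<close>

lemma L_proj_tendsto:
  assumes "x \<in> sobolev lam e 1"
  shows "(\<lambda>N. L (proj N x)) \<longlonglongrightarrow> L x"
proof -
  have *: "x - proj N x \<in> sobolev lam e 1" for N
    using sobolev_add[OF assms sobolev_scaleC[OF proj_in_sobolev[of N x], of "-1"]]
    by (simp flip: scaleR_scaleC[of "-1", simplified])
  have "norm (L (proj N x) - L x) \<le> C * sobolev_norm lam e 1 (x - proj N x)" for N
    using norm_L_le[OF *[of N]] L_diff[OF sobolev_D[OF assms] sobolev_D[OF proj_in_sobolev], of N x]
    by (simp add: norm_minus_commute)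
  then have "(\<lambda>N. L (proj N x) - L x) \<longlonglongrightarrow> 0"
    by (intro Lim_null_comparison[OF _ tendsto_mult_right_zero[OF sobolev_proj_tendsto[OF assms]]])
      (auto intro: always_eventually)
  then show ?thesis by (simp add: LIM_zero_iff)
qed

end

section \<open>Solutions\<close>

lemma AE_lebesgue_on_subset:
  assumes "AE x in lebesgue_on T. P x" "S \<subseteq> T" "S \<in> sets lebesgue" "T \<in> sets lebesgue"
  shows "AE x in lebesgue_on S. P x"
proof -
  have "AE x in lebesgue. x \<in> T \<longrightarrow> P x"
    using assms(1,4) by (simp add: AE_restrict_space_iff)
  then have "AE x in lebesgue. x \<in> S \<longrightarrow> P x"
    by (rule AE_mp) (use assms(2) in auto)
  then show ?thesis using assms(3) by (simp add: AE_restrict_space_iff)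
qed

context relatively_bounded
begin

lemma cinner_L_proj: "cinner (L (proj N x)) y = (\<Sum>j<N. cnj (cinner (e j) x) * cinner (L (e j)) y)"
  by (simp add: L_proj cinner_sum_left cinner_scaleC_left)

text \<open>\<open>L (\<phi> r)\<close> itself is controlled only where \<open>\<phi> r\<close> lies
  in H^1, i.e. for almost every time. The truncation involves just finitely many vectors
  \<open>L (e j)\<close>, hence the continuity in time.\<close>

lemma continuous_on_cinner_L_proj:
  "continuous_on S \<phi> \<Longrightarrow> continuous_on S (\<lambda>r. cinner (L (proj N (\<phi> r))) (\<phi> r))"
  unfolding cinner_L_proj by (intro continuous_intros continuous_on_cinner)

lemma continuous_on_energy: "continuous_on S \<phi> \<Longrightarrow> continuous_on S (\<lambda>r. energy N (\<phi> r))"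
  unfolding energy_def by (intro continuous_intros continuous_on_cinner)

lemma solution_in_sobolev:
  assumes "is_solution lam e L A \<phi>0 \<phi>" "\<tau> > 0"
  shows "AE t in lebesgue_on {0..\<tau>}. \<phi> t \<in> sobolev lam e 1"
  using assms unfolding is_solution_def L2_sobolev_def sobolev_def by auto

lemma solution_continuous:
  assumes "is_solution lam e L A \<phi>0 \<phi>"
  shows "continuous_on {0..\<tau>} \<phi>"
proof -
  have "continuous_on {0..max \<tau> 1} \<phi>"
    using assms unfolding is_solution_def by auto
  then show ?thesis by (rule continuous_on_subset) auto
qed

text \<open>Since \<open>\<langle>e\<^sub>j, L\<phi>\<rangle> = \<langle>Le\<^sub>j, \<phi>\<rangle>\<close> is continuous in time, the coefficients of a weak solution are
  continuously differentiable.\<close>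

lemma solution_coeff_derivative:
  assumes sol: "is_solution lam e L A \<phi>0 \<phi>" and t: "t \<in> {0..\<tau>}"
  shows "((\<lambda>t. cinner (e j) (\<phi> t)) has_vector_derivative
      \<i> * complex_of_real A * cinner (L (e j)) (\<phi> t) - complex_of_real (lam j) * cinner (e j) (\<phi> t))
    (at t within {0..\<tau>})"
proof (cases "\<tau> > 0")
  case \<tau>: True
  define h where "h t = \<i> * complex_of_real A * cinner (L (e j)) (\<phi> t)
    - complex_of_real (lam j) * cinner (e j) (\<phi> t)" for t
  have h_cont: "continuous_on {0..\<tau>} h"
    unfolding h_def by (intro continuous_intros continuous_on_cinner solution_continuous[OF sol])
  obtain \<phi>' where wd: "weak_derivative \<tau> (\<lambda>t. coeffs e (\<phi> t)) \<phi>'"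
    and ae: "AE t in lebesgue_on {0..\<tau>}. \<forall>j. \<phi>' t j = \<i> * complex_of_real A * coeffs e (L (\<phi> t)) j
                       - complex_of_real (lam j) * coeffs e (\<phi> t) j"
    using sol \<tau> unfolding is_solution_def by blast
  \<comment> \<open>Almost every \<open>\<phi> t\<close> lies in H^1 and hence in \<open>D\<close>,
    where symmetry moves \<open>L\<close> onto \<open>e j\<close>; so the weak derivative agrees
    almost everywhere with the continuous function \<open>h\<close>.\<close>
  have aeh: "AE t in lebesgue_on {0..\<tau>}. \<phi>' t j = h t"
    using ae solution_in_sobolev[OF sol \<tau>]
  proof eventually_elim
    case (elim t)
    then show ?case
      using symmetric_L[OF e_in_D sobolev_D, of "\<phi> t" j] by (simp add: h_def coeffs_def)
  qed
  have eq: "cinner (e j) (\<phi> u) = cinner (e j) (\<phi> 0) + integral {0..u} h" if u: "u \<in> {0..\<tau>}" for u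
  proof -
    have sub: "{0..u} \<subseteq> {0..\<tau>}" using u by auto
    have ih: "integrable (lebesgue_on {0..u}) h"
      using h_cont sub by (intro continuous_imp_integrable_real) (rule continuous_on_subset)
    have i': "integrable (lebesgue_on {0..\<tau>}) (\<lambda>s. \<phi>' s j)"
      and e: "cinner (e j) (\<phi> u) = cinner (e j) (\<phi> 0) + integral\<^sup>L (lebesgue_on {0..u}) (\<lambda>s. \<phi>' s j)"
      using wd u unfolding weak_derivative_def coeffs_def by blast+
    have "integral\<^sup>L (lebesgue_on {0..u}) (\<lambda>s. \<phi>' s j) = integral\<^sup>L (lebesgue_on {0..u}) h"
      by (intro integral_cong_AE AE_lebesgue_on_subset[OF aeh sub] borel_measurable_integrable ih
          Equivalence_Lebesgue_Henstock_Integration.integrable_subinterval[OF i' sub]) simp_all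
    then show ?thesis using e lebesgue_integral_eq_integral[OF ih] by simp
  qed
  have "((\<lambda>u. cinner (e j) (\<phi> 0) + integral {0..u} h) has_vector_derivative (0 + h t)) (at t within {0..\<tau>})"
    by (intro has_vector_derivative_add has_vector_derivative_const
        integral_has_vector_derivative[OF h_cont t])
  then have D: "((\<lambda>u. cinner (e j) (\<phi> 0) + integral {0..u} h) has_vector_derivative h t) (at t within {0..\<tau>})"
    by simp
  show ?thesis
    unfolding h_def[symmetric]
    by (rule has_vector_derivative_transform[OF t _ D]) (rule eq)
next
  \<comment> \<open>Here \<open>\<tau> = 0\<close>, and on a one-point interval every derivative
    claim holds.\<close>
  case False
  with t have "{0..\<tau>} = {t}" by auto
  then show ?thesis
    by (simp only: has_vector_derivative_def has_derivative_within_singleton_iff bounded_linear_scaleR_left)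
qed

text \<open>Differentiating the squared norm of \<open>proj N (\<phi> r)\<close> yields the
  dissipation \<open>- 2 * energy N (\<phi> r)\<close> and a term from \<open>L\<close>. The
  integral of the latter vanishes as \<open>N\<close> grows because \<open>cinner (L x) x\<close> is
  real, so \<open>A\<close> disappears from the bound.\<close>

lemma solution_energy:
  assumes sol: "is_solution lam e L A \<phi>0 \<phi>" and s: "0 \<le> s" and st: "s \<le> t"
  shows "(norm (\<phi> t))\<^sup>2 + 2 * integral {s..t} (\<lambda>r. energy M (\<phi> r)) \<le> (norm (\<phi> s))\<^sup>2"
proof -
  \<comment> \<open>The added 1 keeps the horizon positive when \<open>t = 0\<close>, as the
    solution properties on \<open>{0..\<tau>}\<close> require.\<close>
  define \<tau> where "\<tau> = t + 1"
  have \<tau>: "\<tau> > 0" and sub: "{s..t} \<subseteq> {0..\<tau>}" using s st by (auto simp: \<tau>_def)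
  have cont: "continuous_on {s..t} \<phi>"
    using solution_continuous[OF sol] sub by (rule continuous_on_subset)
  \<comment> \<open>The contribution of \<open>L\<close> to the derivative of the squared norm of
    \<open>proj N (\<phi> r)\<close>. It need not vanish for finite \<open>N\<close>, since
    \<open>L\<close> need not commute with the projections.\<close>
  define rest where "rest N r = - 2 * A * Im (cinner (L (proj N (\<phi> r))) (\<phi> r))" for N r
  have rest_cont: "continuous_on {s..t} (rest N)" for N
    unfolding rest_def by (intro continuous_intros continuous_on_cinner_L_proj cont)
  have FTC: "((\<lambda>r. rest N r - 2 * energy N (\<phi> r)) has_integral
      ((norm (proj N (\<phi> t)))\<^sup>2 - (norm (proj N (\<phi> s)))\<^sup>2)) {s..t}" for N
  proof (rule fundamental_theorem_of_calculus[OF st])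
    fix r assume r: "r \<in> {s..t}"
    let ?c = "\<lambda>j r. cinner (e j) (\<phi> r)"
    let ?h = "\<lambda>j. \<i> * complex_of_real A * cinner (L (e j)) (\<phi> r) - complex_of_real (lam j) * ?c j r"
    have "(?c j has_vector_derivative ?h j) (at r within {s..t})" for j
      using solution_coeff_derivative[OF sol, of r \<tau> j] r sub
      by (auto intro: has_vector_derivative_within_subset)
    from bounded_bilinear.has_vector_derivative[OF bounded_bilinear_inner this this]
    have "((\<lambda>r. \<Sum>j<N. ?c j r \<bullet> ?c j r) has_vector_derivative (\<Sum>j<N. ?c j r \<bullet> ?h j + ?h j \<bullet> ?c j r))
        (at r within {s..t})"
      by (intro has_vector_derivative_sum)
    moreover have "(\<Sum>j<N. ?c j r \<bullet> ?c j r) = (norm (proj N (\<phi> r)))\<^sup>2" for r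
      unfolding norm_proj by (intro sum.cong refl) (simp add: power2_norm_eq_inner)
    moreover have "(\<Sum>j<N. ?c j r \<bullet> ?h j + ?h j \<bullet> ?c j r) = rest N r - 2 * energy N (\<phi> r)"
      unfolding rest_def energy_def cinner_L_proj Im_sum sum_distrib_left sum_subtractf[symmetric]
      unfolding cmod_power2
      by (intro sum.cong refl) (simp add: inner_complex_def algebra_simps power2_eq_square)
    ultimately show "((\<lambda>r. (norm (proj N (\<phi> r)))\<^sup>2) has_vector_derivative
        rest N r - 2 * energy N (\<phi> r)) (at r within {s..t})" by simp
  qed
  have int_rest: "rest N integrable_on {s..t}" for N
    by (intro integrable_continuous_real rest_cont)
  have int_energy: "(\<lambda>r. energy N (\<phi> r)) integrable_on {s..t}" for N
    by (intro integrable_continuous_real continuous_on_energy cont)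
  have eq: "(norm (proj N (\<phi> t)))\<^sup>2 + 2 * integral {s..t} (\<lambda>r. energy N (\<phi> r))
      = (norm (proj N (\<phi> s)))\<^sup>2 + integral {s..t} (rest N)" for N
    using integral_unique[OF FTC[of N]] int_rest[of N] int_energy[of N]
    by (simp add: integral_diff integrable_on_mult_right)
  have "(\<lambda>N. integral\<^sup>L (lebesgue_on {s..t}) (rest N)) \<longlonglongrightarrow> integral\<^sup>L (lebesgue_on {s..t}) (\<lambda>_. 0)"
  proof (rule integral_dominated_convergence)
    \<comment> \<open>The majorant comes from 2ab \<le> a^2 + b^2; it is integrable because
      solutions are square integrable with values in H^1.\<close>
    let ?w = "\<lambda>r. \<bar>A\<bar> * \<bar>C\<bar> * ((norm (\<phi> r))\<^sup>2 + (sobolev_norm lam e 1 (\<phi> r))\<^sup>2)"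
    have ae: "AE r in lebesgue_on {s..t}. \<phi> r \<in> sobolev lam e 1"
      by (rule AE_lebesgue_on_subset[OF solution_in_sobolev[OF sol \<tau>] sub]) auto
    have "integrable (lebesgue_on {0..\<tau>}) (\<lambda>r. (sobolev_norm lam e 1 (\<phi> r))\<^sup>2)"
      using sol \<tau> unfolding is_solution_def L2_sobolev_def sobolev_norm_def by auto
    then have "integrable (lebesgue_on {s..t}) (\<lambda>r. (sobolev_norm lam e 1 (\<phi> r))\<^sup>2)"
      using sub by (rule Equivalence_Lebesgue_Henstock_Integration.integrable_subinterval)
    moreover have "integrable (lebesgue_on {s..t}) (\<lambda>r. (norm (\<phi> r))\<^sup>2)"
      by (intro continuous_imp_integrable_real continuous_intros cont)
    ultimately show "integrable (lebesgue_on {s..t}) ?w" by simp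
    show "rest N \<in> borel_measurable (lebesgue_on {s..t})" for N
      using continuous_imp_integrable_real[OF rest_cont] by auto
    show "AE r in lebesgue_on {s..t}. (\<lambda>N. rest N r) \<longlonglongrightarrow> 0"
      using ae
    proof eventually_elim
      case (elim r)
      have "(\<lambda>N. cinner (L (proj N (\<phi> r))) (\<phi> r)) \<longlonglongrightarrow> cinner (L (\<phi> r)) (\<phi> r)"
        by (intro tendsto_cinner L_proj_tendsto elim tendsto_const)
      then have "(\<lambda>N. rest N r) \<longlonglongrightarrow> - 2 * A * Im (cinner (L (\<phi> r)) (\<phi> r))"
        unfolding rest_def by (intro tendsto_intros)
      moreover have "Im (cinner (L (\<phi> r)) (\<phi> r)) = 0"
        using Im_cinner_L[OF sobolev_D[OF elim]] symmetric_L[of "\<phi> r" "\<phi> r"] sobolev_D[OF elim] by simp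
      ultimately show ?case by simp
    qed
    show "AE r in lebesgue_on {s..t}. norm (rest N r) \<le> ?w r" for N
      using ae
    proof eventually_elim
      case (elim r)
      let ?n = "norm (\<phi> r)" and ?m = "sobolev_norm lam e 1 (\<phi> r)"
      have m: "0 \<le> ?m" by (rule sobolev_norm_nonneg[OF elim])
      \<comment> \<open>Symmetry moves \<open>L\<close> off the projection, so that \<open>N\<close>
        enters only through \<open>norm (proj N (\<phi> r))\<close>, which is at most
        \<open>norm (\<phi> r)\<close>.\<close>
      have "\<bar>Im (cinner (L (proj N (\<phi> r))) (\<phi> r))\<bar> \<le> cmod (cinner (proj N (\<phi> r)) (L (\<phi> r)))"
        using symmetric_L[OF sobolev_D[OF proj_in_sobolev] sobolev_D[OF elim]] abs_Im_le_cmod by metis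
      also have "\<dots> \<le> norm (proj N (\<phi> r)) * norm (L (\<phi> r))" by (rule norm_cinner_le)
      also have "\<dots> \<le> ?n * (\<bar>C\<bar> * ?m)"
      proof (rule mult_mono)
        show "norm (L (\<phi> r)) \<le> \<bar>C\<bar> * ?m"
          using norm_L_le[OF elim] mult_right_mono[OF abs_ge_self m] order_trans by blast
      qed (auto simp: norm_proj_le)
      finally have "2 * \<bar>A\<bar> * \<bar>Im (cinner (L (proj N (\<phi> r))) (\<phi> r))\<bar> \<le> 2 * \<bar>A\<bar> * (?n * (\<bar>C\<bar> * ?m))"
        by (rule mult_left_mono) simp
      also have "\<dots> = \<bar>A\<bar> * \<bar>C\<bar> * (2 * ?n * ?m)" by (simp add: mult_ac)
      also have "\<dots> \<le> ?w r"
        using zero_le_power2[of "?n - ?m"] by (intro mult_left_mono) (auto simp: power2_diff)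
      finally show ?case by (simp add: rest_def abs_mult)
    qed
  qed auto
  then have rest_lim: "(\<lambda>N. integral {s..t} (rest N)) \<longlonglongrightarrow> 0"
    by (simp add: lebesgue_integral_eq_integral continuous_imp_integrable_real[OF rest_cont])
  show ?thesis
  proof (rule LIMSEQ_le)
    show "(\<lambda>N. (norm (proj N (\<phi> t)))\<^sup>2 + 2 * integral {s..t} (\<lambda>r. energy M (\<phi> r)))
        \<longlonglongrightarrow> (norm (\<phi> t))\<^sup>2 + 2 * integral {s..t} (\<lambda>r. energy M (\<phi> r))"
      by (intro tendsto_add norm_proj_tendsto tendsto_const)
    show "(\<lambda>N. (norm (proj N (\<phi> s)))\<^sup>2 + integral {s..t} (rest N)) \<longlonglongrightarrow> (norm (\<phi> s))\<^sup>2"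
      using tendsto_add[OF norm_proj_tendsto rest_lim] by simp
    \<comment> \<open>The level \<open>M\<close> stays fixed while \<open>N\<close> tends to
      infinity; monotonicity of the energy in the level replaces a limit of the energy
      integrals.\<close>
    have "integral {s..t} (\<lambda>r. energy M (\<phi> r)) \<le> integral {s..t} (\<lambda>r. energy N (\<phi> r))" if "M \<le> N" for N
      by (intro integral_le int_energy energy_mono that)
    then show "\<exists>K. \<forall>N\<ge>K. (norm (proj N (\<phi> t)))\<^sup>2 + 2 * integral {s..t} (\<lambda>r. energy M (\<phi> r))
        \<le> (norm (proj N (\<phi> s)))\<^sup>2 + integral {s..t} (rest N)"
      using eq by (intro exI[of _ M]) (smt (verit))
  qed
qed

lemma solution_norm_le:
  assumes sol: "is_solution lam e L A \<phi>0 \<phi>" and "0 \<le> s" "s \<le> t"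
  shows "norm (\<phi> t) \<le> norm (\<phi> s)"
  \<comment> \<open>At level 0 the energy is an empty sum, which leaves only the norms.\<close>
  using solution_energy[OF assms, of 0] by (simp add: energy_def power2_le_iff_abs_le)

text \<open>The dissipation is paid for by the initial squared norm. The bound is uniform in
  \<open>A\<close>, which is the source of compactness as \<open>A\<close> tends to
  infinity.\<close>

lemma solution_energy_integral_le:
  assumes sol: "is_solution lam e L A \<phi>0 \<phi>" and "norm \<phi>0 = 1" "0 \<le> \<tau>"
  shows "integral {0..\<tau>} (\<lambda>r. energy N (\<phi> r)) \<le> 1 / 2"
proof -
  have "(norm (\<phi> 0))\<^sup>2 = 1" using sol assms(2) by (simp add: is_solution_def)
  then show ?thesis
    using solution_energy[OF sol order_refl assms(3), of N] zero_le_power2[of "norm (\<phi> \<tau>)"]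
    by linarith
qed

end

text \<open>Cauchy-Schwarz against the constant 1, in the form that the integrated squared deviation
  of \<open>f\<close> from its mean \<open>m\<close> is nonnegative.\<close>

lemma integral_square_le:
  fixes f :: "real \<Rightarrow> real"
  assumes "continuous_on {0..\<tau>} f" "0 \<le> \<tau>"
  shows "(integral {0..\<tau>} f)\<^sup>2 \<le> \<tau> * integral {0..\<tau>} (\<lambda>t. (f t)\<^sup>2)"
proof (cases "\<tau> = 0")
  case False
  define m where "m = integral {0..\<tau>} f / \<tau>"
  have f: "(f has_integral m * \<tau>) {0..\<tau>}"
    using integrable_integral[OF integrable_continuous_real[OF assms(1)]] False by (simp add: m_def)
  have f2: "((\<lambda>t. (f t)\<^sup>2) has_integral integral {0..\<tau>} (\<lambda>t. (f t)\<^sup>2)) {0..\<tau>}"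
    by (intro integrable_integral integrable_continuous_real continuous_intros assms(1))
  have "((\<lambda>t. (f t)\<^sup>2 - (2 * m) * f t + m\<^sup>2) has_integral
      (integral {0..\<tau>} (\<lambda>t. (f t)\<^sup>2) - (2 * m) * (m * \<tau>) + \<tau> * m\<^sup>2)) {0..\<tau>}"
    using has_integral_const_real[of "m\<^sup>2" 0 \<tau>] assms(2)
    by (intro has_integral_add has_integral_diff f2 has_integral_mult_right f) simp
  then have "0 \<le> integral {0..\<tau>} (\<lambda>t. (f t)\<^sup>2) - (2 * m) * (m * \<tau>) + \<tau> * m\<^sup>2"
  proof (rule has_integral_nonneg)
    show "0 \<le> (f t)\<^sup>2 - 2 * m * f t + m\<^sup>2" for t
      using zero_le_power2[of "f t - m"] by (simp add: power2_diff mult_ac)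
  qed
  then have "\<tau> * (\<tau> * m\<^sup>2) \<le> \<tau> * integral {0..\<tau>} (\<lambda>t. (f t)\<^sup>2)"
    using assms(2) by (intro mult_left_mono) (auto simp: power2_eq_square mult_ac)
  moreover have "integral {0..\<tau>} f = \<tau> * m" using False by (simp add: m_def)
  ultimately show ?thesis by (simp add: power_mult_distrib power2_eq_square mult_ac)
qed simp

section \<open>Time averages of rank-one operators\<close>

text \<open>Despite the name there is no division by \<open>\<tau>\<close>. For continuous
  \<open>\<phi>\<close> the trace of this positive operator is the integral of the squared norm of
  \<open>\<phi> t\<close>.\<close>

definition time_average :: "real \<Rightarrow> (real \<Rightarrow> 'h) \<Rightarrow> 'h \<Rightarrow> 'h::chilbert_space" where
  "time_average \<tau> \<phi> v = integral {0..\<tau>} (\<lambda>t. cinner (\<phi> t) v *\<^sub>C \<phi> t)"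

lemma time_average_integrable:
  fixes \<phi> :: "real \<Rightarrow> 'h::chilbert_space"
  assumes "continuous_on {0..\<tau>} \<phi>"
  shows "(\<lambda>t. cinner (\<phi> t) v *\<^sub>C \<phi> t) integrable_on {0..\<tau>}"
  by (intro integrable_continuous_real continuous_on_scaleC continuous_on_cinner
      continuous_on_const assms)

lemma cinner_time_average:
  fixes \<phi> :: "real \<Rightarrow> 'h::chilbert_space"
  assumes "continuous_on {0..\<tau>} \<phi>"
  shows "cinner u (time_average \<tau> \<phi> v) = integral {0..\<tau>} (\<lambda>t. cinner (\<phi> t) v * cinner u (\<phi> t))"
  using integral_linear[OF time_average_integrable[OF assms] bounded_linear_cinner_right, of u v]
  by (simp add: time_average_def o_def cinner_scaleC_right)

lemma cinner_time_average_commute: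
  fixes \<phi> :: "real \<Rightarrow> 'h::chilbert_space"
  assumes "continuous_on {0..\<tau>} \<phi>"
  shows "cinner u (time_average \<tau> \<phi> v) = cinner (time_average \<tau> \<phi> u) v"
proof -
  have "cinner (time_average \<tau> \<phi> u) v = cnj (cinner v (time_average \<tau> \<phi> u))"
    by (rule cinner_commute)
  also have "\<dots> = integral {0..\<tau>} (\<lambda>t. cinner u (\<phi> t) * cinner (\<phi> t) v)"
    unfolding cinner_time_average[OF assms] integral_cnj
    by (simp add: cinner_commute[symmetric])
  finally show ?thesis by (simp add: cinner_time_average[OF assms] mult.commute)
qed

lemma time_average_add:
  fixes \<phi> :: "real \<Rightarrow> 'h::chilbert_space"
  assumes "continuous_on {0..\<tau>} \<phi>"
  shows "time_average \<tau> \<phi> (u + v) = time_average \<tau> \<phi> u + time_average \<tau> \<phi> v"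
  unfolding time_average_def cinner_add_right scaleC_add_left
  by (rule Henstock_Kurzweil_Integration.integral_add) (intro time_average_integrable assms)+

lemma time_average_scaleC:
  fixes \<phi> :: "real \<Rightarrow> 'h::chilbert_space"
  assumes "continuous_on {0..\<tau>} \<phi>"
  shows "time_average \<tau> \<phi> (a *\<^sub>C v) = a *\<^sub>C time_average \<tau> \<phi> v"
  using integral_linear[OF time_average_integrable[OF assms]
      bounded_bilinear.bounded_linear_right[OF bounded_bilinear_scaleC], of a v]
  by (simp add: time_average_def o_def cinner_scaleC_right scaleC_scaleC)

lemma time_average_diff:
  fixes \<phi> :: "real \<Rightarrow> 'h::chilbert_space"
  assumes "continuous_on {0..\<tau>} \<phi>"
  shows "time_average \<tau> \<phi> (u - v) = time_average \<tau> \<phi> u - time_average \<tau> \<phi> v"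
  using time_average_add[OF assms, of "u - v" v] by (simp add: algebra_simps)

lemma norm_time_average_le:
  fixes \<phi> :: "real \<Rightarrow> 'h::chilbert_space"
  assumes cont: "continuous_on {0..\<tau>} \<phi>" and "0 \<le> \<tau>" and le: "\<And>t. t \<in> {0..\<tau>} \<Longrightarrow> norm (\<phi> t) \<le> 1"
  shows "norm (time_average \<tau> \<phi> v) \<le> \<tau> * norm v"
proof -
  have "norm (time_average \<tau> \<phi> v) \<le> integral {0..\<tau>} (\<lambda>t. norm v)"
    unfolding time_average_def
  proof (rule Henstock_Kurzweil_Integration.integral_norm_bound_integral[OF time_average_integrable[OF cont]])
    fix t assume t: "t \<in> {0..\<tau>}"
    have "norm (cinner (\<phi> t) v *\<^sub>C \<phi> t) \<le> (1 * norm v) * 1"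
      unfolding norm_scaleC
      using norm_cinner_le[of "\<phi> t" v] mult_right_mono[OF le[OF t], of "norm v"] le[OF t]
      by (intro mult_mono) auto
    then show "norm (cinner (\<phi> t) v *\<^sub>C \<phi> t) \<le> norm v" by simp
  qed auto
  then show ?thesis using assms(2) by simp
qed

section \<open>Compactness of time averages\<close>

context eigenbasis
begin

text \<open>Each coefficient of the image of \<open>v\<close> is at most \<open>norm v\<close> times
  the integral of the modulus of that coefficient of \<open>\<phi>\<close>.
  \<open>integral_square_le\<close> passes to squares, and summing with the weights
  \<open>lam j\<close> recovers the energy of \<open>\<phi>\<close>.\<close>

lemma energy_time_average_le:
  assumes cont: "continuous_on {0..\<tau>} \<phi>" and \<tau>: "0 \<le> \<tau>"
    and en: "integral {0..\<tau>} (\<lambda>t. energy N (\<phi> t)) \<le> R"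
    and le: "\<And>t. t \<in> {0..\<tau>} \<Longrightarrow> norm (\<phi> t) \<le> 1"
  shows "energy N (time_average \<tau> \<phi> v) \<le> \<tau> * R * (norm v)\<^sup>2"
proof -
  let ?c = "\<lambda>j t. cmod (cinner (e j) (\<phi> t))"
  have c_cont: "continuous_on {0..\<tau>} (?c j)" for j
    by (intro continuous_intros continuous_on_cinner cont)
  have coeff: "(cmod (cinner (e j) (time_average \<tau> \<phi> v)))\<^sup>2 \<le> (norm v)\<^sup>2 * (\<tau> * integral {0..\<tau>} (\<lambda>t. (?c j t)\<^sup>2))" for j
  proof -
    have "cmod (cinner (e j) (time_average \<tau> \<phi> v)) \<le> integral {0..\<tau>} (\<lambda>t. norm v * ?c j t)"
      unfolding cinner_time_average[OF cont]
    proof (rule Henstock_Kurzweil_Integration.integral_norm_bound_integral)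
      fix t assume t: "t \<in> {0..\<tau>}"
      have "cmod (cinner (\<phi> t) v) \<le> 1 * norm v"
        using norm_cinner_le[of "\<phi> t" v] mult_right_mono[OF le[OF t], of "norm v"] by simp
      then show "cmod (cinner (\<phi> t) v * cinner (e j) (\<phi> t)) \<le> norm v * ?c j t"
        by (simp add: norm_mult mult_right_mono)
    qed (intro integrable_continuous_real continuous_intros continuous_on_cinner cont)+
    also have "\<dots> = norm v * integral {0..\<tau>} (?c j)" by simp
    finally have "(cmod (cinner (e j) (time_average \<tau> \<phi> v)))\<^sup>2 \<le> (norm v * integral {0..\<tau>} (?c j))\<^sup>2"
      by (rule power_mono) simp
    also have "\<dots> \<le> (norm v)\<^sup>2 * (\<tau> * integral {0..\<tau>} (\<lambda>t. (?c j t)\<^sup>2))"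
      unfolding power_mult_distrib by (intro mult_left_mono integral_square_le c_cont \<tau>) simp
    finally show ?thesis .
  qed
  have "energy N (time_average \<tau> \<phi> v)
      \<le> (\<Sum>j<N. lam j * ((norm v)\<^sup>2 * (\<tau> * integral {0..\<tau>} (\<lambda>t. (?c j t)\<^sup>2))))"
    unfolding energy_def by (intro sum_mono mult_left_mono coeff) (simp add: less_imp_le lam_pos)
  also have "\<dots> = (norm v)\<^sup>2 * \<tau> * (\<Sum>j<N. integral {0..\<tau>} (\<lambda>t. lam j * (?c j t)\<^sup>2))"
    by (simp add: sum_distrib_left mult_ac)
  also have "(\<Sum>j<N. integral {0..\<tau>} (\<lambda>t. lam j * (?c j t)\<^sup>2)) = integral {0..\<tau>} (\<lambda>t. energy N (\<phi> t))"
    unfolding energy_def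
    by (intro integral_sum[symmetric] integrable_continuous_real continuous_intros c_cont) simp
  also have "(norm v)\<^sup>2 * \<tau> * \<dots> \<le> (norm v)\<^sup>2 * \<tau> * R"
    by (intro mult_left_mono en) (simp add: \<tau>)
  finally show ?thesis by (simp add: mult_ac)
qed

text \<open>By the bound on the energy, not much of the trace can lie beyond the first \<open>N\<close> basis vectors.\<close>

lemma time_average_trace_ge:
  assumes cont: "continuous_on {0..\<tau>} \<phi>" and \<tau>: "0 \<le> \<tau>"
    and en: "\<And>M. integral {0..\<tau>} (\<lambda>t. energy M (\<phi> t)) \<le> R"
    and le: "\<And>t. t \<in> {0..\<tau>} \<Longrightarrow> norm (\<phi> t) \<le> 1"
    and ge: "\<And>t. t \<in> {0..\<tau>} \<Longrightarrow> \<delta> \<le> (norm (\<phi> t))\<^sup>2"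
  shows "\<tau> * \<delta> - R / lam N \<le> (\<Sum>j<N. Re (cinner (e j) (time_average \<tau> \<phi> (e j))))"
proof -
  have pc: "continuous_on {0..\<tau>} (\<lambda>t. (norm (proj M (\<phi> t)))\<^sup>2)" for M
    unfolding norm_proj by (intro continuous_intros continuous_on_cinner cont)
  have int_p: "(\<lambda>t. (norm (proj M (\<phi> t)))\<^sup>2) integrable_on {0..\<tau>}" for M
    by (rule integrable_continuous_real[OF pc])
  have ec: "(\<lambda>t. energy M (\<phi> t)) integrable_on {0..\<tau>}" for M
    unfolding energy_def
    by (intro integrable_continuous_real continuous_intros continuous_on_cinner cont)
  \<comment> \<open>The tail bound is applied at each time with \<open>energy M (\<phi> t)\<close>
    itself in place of \<open>R\<close> and then integrated.\<close>
  have up: "integral {0..\<tau>} (\<lambda>t. (norm (proj M (\<phi> t)))\<^sup>2)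
      \<le> integral {0..\<tau>} (\<lambda>t. (norm (proj N (\<phi> t)))\<^sup>2) + R / lam N" for M
  proof -
    have "integral {0..\<tau>} (\<lambda>t. (norm (proj M (\<phi> t)))\<^sup>2)
        \<le> integral {0..\<tau>} (\<lambda>t. (norm (proj N (\<phi> t)))\<^sup>2 + energy M (\<phi> t) / lam N)"
      by (intro integral_le int_p integrable_add integrable_on_divide ec norm_proj_tail order_refl)
    also have "\<dots> = integral {0..\<tau>} (\<lambda>t. (norm (proj N (\<phi> t)))\<^sup>2) + integral {0..\<tau>} (\<lambda>t. energy M (\<phi> t)) / lam N"
      by (subst Henstock_Kurzweil_Integration.integral_add) (auto intro: int_p integrable_on_divide ec)
    also have "\<dots> \<le> integral {0..\<tau>} (\<lambda>t. (norm (proj N (\<phi> t)))\<^sup>2) + R / lam N"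
      by (intro add_left_mono divide_right_mono en) (simp add: less_imp_le lam_pos)
    finally show ?thesis .
  qed
  have lim: "(\<lambda>M. integral {0..\<tau>} (\<lambda>t. (norm (proj M (\<phi> t)))\<^sup>2)) \<longlonglongrightarrow> integral {0..\<tau>} (\<lambda>t. (norm (\<phi> t))\<^sup>2)"
  proof (rule dominated_convergence(2)[where h = "\<lambda>_. 1"])
    fix M t assume "t \<in> {0..\<tau>}"
    then have "norm (proj M (\<phi> t)) \<le> 1" using norm_proj_le le order_trans by blast
    then show "norm ((norm (proj M (\<phi> t)))\<^sup>2) \<le> 1" by (simp add: power_le_one)
  qed (auto intro: int_p norm_proj_tendsto)
  have "\<tau> * \<delta> = integral {0..\<tau>} (\<lambda>t. \<delta>)" using \<tau> by simp
  also have "\<dots> \<le> integral {0..\<tau>} (\<lambda>t. (norm (\<phi> t))\<^sup>2)"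
    by (intro integral_le integrable_continuous_real continuous_intros cont ge)
  also have "\<dots> \<le> integral {0..\<tau>} (\<lambda>t. (norm (proj N (\<phi> t)))\<^sup>2) + R / lam N"
    by (rule LIMSEQ_le_const2[OF lim]) (use up in blast)
  also have "integral {0..\<tau>} (\<lambda>t. (norm (proj N (\<phi> t)))\<^sup>2)
      = (\<Sum>j<N. Re (cinner (e j) (time_average \<tau> \<phi> (e j))))"
  proof -
    \<comment> \<open>Each diagonal entry is the integral of a squared coefficient of
      \<open>\<phi>\<close>, so the partial trace is the integral of the squared norm of
      \<open>proj N (\<phi> t)\<close>.\<close>
    have "Re (cinner (e j) (time_average \<tau> \<phi> (e j))) = integral {0..\<tau>} (\<lambda>t. (cmod (cinner (e j) (\<phi> t)))\<^sup>2)" for j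
    proof -
      have "cinner (\<phi> t) (e j) * cinner (e j) (\<phi> t) = complex_of_real ((cmod (cinner (e j) (\<phi> t)))\<^sup>2)" for t
        using complex_norm_square[of "cinner (e j) (\<phi> t)"] cinner_commute[of "\<phi> t" "e j"] by (simp add: mult.commute)
      moreover have "integral {0..\<tau>} (\<lambda>t. complex_of_real ((cmod (cinner (e j) (\<phi> t)))\<^sup>2))
        = complex_of_real (integral {0..\<tau>} (\<lambda>t. (cmod (cinner (e j) (\<phi> t)))\<^sup>2))"
        by (rule integral_linear[unfolded o_def, OF _ bounded_linear_of_real])
          (intro integrable_continuous_real continuous_intros continuous_on_cinner cont)
      ultimately show ?thesis by (simp add: cinner_time_average[OF cont])
    qed
    then show ?thesis
      unfolding norm_proj
      by (subst integral_sum) (auto intro!: integrable_continuous_real continuous_intros continuous_on_cinner cont)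
  qed
  finally show ?thesis by simp
qed

text \<open>A diagonal argument makes all matrix entries converge. The energy bound upgrades this to
  norm convergence on each \<open>e k\<close>, and the uniform operator bound \<open>\<tau>\<close>
  extends it from finite combinations to every vector.\<close>

lemma time_average_subsequence:
  assumes cont: "\<And>n. continuous_on {0..\<tau>} (\<phi> n)" and \<tau>: "0 \<le> \<tau>"
    and en: "\<And>n M. integral {0..\<tau>} (\<lambda>t. energy M (\<phi> n t)) \<le> R"
    and le: "\<And>n t. t \<in> {0..\<tau>} \<Longrightarrow> norm (\<phi> n t) \<le> 1"
  obtains r :: "nat \<Rightarrow> nat" and X where "strict_mono r"
    "\<And>v. (\<lambda>n. time_average \<tau> (\<phi> (r n)) v) \<longlonglongrightarrow> X v"
proof -
  note bnd = norm_time_average_le[OF cont \<tau> le]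
  have K: "cmod (cinner (e (fst p)) (time_average \<tau> (\<phi> n) (e (snd p)))) \<le> \<tau>" for n p
    using norm_cinner_le[of "e (fst p)" "time_average \<tau> (\<phi> n) (e (snd p))"] bnd[of n "e (snd p)"]
    by (simp add: norm_e)
  obtain r :: "nat \<Rightarrow> nat" where r: "strict_mono r"
    and conv: "\<And>p. p \<in> UNIV \<Longrightarrow> \<exists>l. (\<lambda>n. cinner (e (fst p)) (time_average \<tau> (\<phi> (r n)) (e (snd p)))) \<longlonglongrightarrow> l"
    by (rule function_convergent_subsequence[of UNIV
          "\<lambda>n p. cinner (e (fst p)) (time_average \<tau> (\<phi> n) (e (snd p)))" \<tau>])
      (use K in \<open>simp_all\<close>)
  let ?X = "\<lambda>n. time_average \<tau> (\<phi> (r n))"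
  have conv_e: "convergent (\<lambda>n. ?X n (e k))" for k
  proof (rule convergent_if_coeffs_convergent)
    show "convergent (\<lambda>n. cinner (e j) (?X n (e k)))" for j
      using conv[of "(j, k)"] by (simp add: convergent_def)
    show "energy N (?X n (e k)) \<le> \<tau> * R * (norm (e k))\<^sup>2" for n N
      by (rule energy_time_average_le[OF cont \<tau> en le])
  qed
  have conv_proj: "convergent (\<lambda>n. ?X n (proj N v))" for N v
  proof (induction N)
    case 0
    have "?X n 0 = 0" for n
      using bnd[of "r n" 0] by simp
    then show ?case by (simp add: proj_def convergent_const)
  next
    case (Suc N)
    have "?X n (proj (Suc N) v) = ?X n (proj N v) + cinner (e N) v *\<^sub>C ?X n (e N)" for n
      by (simp add: proj_def time_average_add[OF cont] time_average_scaleC[OF cont])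
    moreover obtain l l' where "(\<lambda>n. ?X n (proj N v)) \<longlonglongrightarrow> l" "(\<lambda>n. ?X n (e N)) \<longlonglongrightarrow> l'"
      using Suc conv_e[of N] by (auto simp: convergent_def)
    ultimately show ?case
      using tendsto_add[OF _ bounded_bilinear.tendsto[OF bounded_bilinear_scaleC tendsto_const]]
      by (fastforce simp: convergent_def)
  qed
  have "convergent (\<lambda>n. ?X n v)" for v
  proof (rule Cauchy_convergent, rule metric_CauchyI)
    fix \<epsilon> :: real assume \<epsilon>: "\<epsilon> > 0"
    \<comment> \<open>The uniform operator bound makes replacing \<open>v\<close> by
      \<open>proj N v\<close> cost less than \<open>\<epsilon> / 3\<close> for all \<open>n\<close>
      at once.\<close>
    have "(\<lambda>N. \<tau> * norm (v - proj N v)) \<longlonglongrightarrow> \<tau> * norm (v - v)"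
      by (intro tendsto_intros proj_tendsto)
    then have "\<forall>\<^sub>F N in sequentially. \<tau> * norm (v - proj N v) < \<epsilon> / 3"
      by (rule order_tendstoD) (use \<epsilon> in simp)
    then obtain N where N: "\<tau> * norm (v - proj N v) < \<epsilon> / 3" by (auto simp: eventually_sequentially)
    have near: "dist (?X n v) (?X n (proj N v)) < \<epsilon> / 3" for n
      using bnd[of "r n" "v - proj N v"] N by (simp add: time_average_diff[OF cont] dist_norm)
    obtain K where K: "\<And>m n. m \<ge> K \<Longrightarrow> n \<ge> K \<Longrightarrow> dist (?X m (proj N v)) (?X n (proj N v)) < \<epsilon> / 3"
      using metric_CauchyD[OF convergent_Cauchy[OF conv_proj], of "\<epsilon> / 3" N v] \<epsilon> by auto
    show "\<exists>K. \<forall>m\<ge>K. \<forall>n\<ge>K. dist (?X m v) (?X n v) < \<epsilon>"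
    proof (intro exI allI impI)
      fix m n assume "m \<ge> K" "n \<ge> K"
      from K[OF this] near[of m] near[of n] show "dist (?X m v) (?X n v) < \<epsilon>"
        using dist_triangle[of "?X m v" "?X n v" "?X m (proj N v)"]
          dist_triangle[of "?X m (proj N v)" "?X n v" "?X n (proj N v)"]
        by (simp add: dist_commute)
    qed
  qed
  then obtain X where "\<And>v. (\<lambda>n. ?X n v) \<longlonglongrightarrow> X v" unfolding convergent_def by metis
  with r that show thesis by blast
qed

end

section \<open>Commutator estimate, and overlap of solutions with an eigenvector\<close>

context relatively_bounded
begin

text \<open>Time integration of \<open>(d/dt) \<langle>e\<^sub>j,\<phi>\<rangle>\<langle>\<phi>,e\<^sub>k\<rangle>\<close>: all terms without the factor \<open>A\<close> are bounded.\<close>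

lemma time_average_commutator:
  assumes sol: "is_solution lam e L A \<phi>0 \<phi>" and \<tau>: "0 \<le> \<tau>" and norm: "norm \<phi>0 = 1"
  shows "\<bar>A\<bar> * cmod (cinner (L (e j)) (time_average \<tau> \<phi> (e k)) - cinner (e j) (time_average \<tau> \<phi> (L (e k))))
    \<le> 2 + (lam j + lam k) * \<tau>"
proof -
  note cont = solution_continuous[OF sol, of \<tau>]
  let ?c = "\<lambda>j t. cinner (e j) (\<phi> t)"
  have le1: "norm (\<phi> t) \<le> 1" if "t \<in> {0..\<tau>}" for t
    using solution_norm_le[OF sol order_refl, of t] that norm sol by (simp add: is_solution_def)
  have cle: "cmod (?c j t) \<le> 1" if "t \<in> {0..\<tau>}" for j t
    using norm_cinner_le[of "e j" "\<phi> t"] le1[OF that] by (simp add: norm_e)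
  have ccle: "cmod (?c j t * cnj (?c k t)) \<le> 1" if "t \<in> {0..\<tau>}" for t
    using mult_mono[OF cle[OF that, of j] cle[OF that, of k]] by (simp add: norm_mult)
  \<comment> \<open>As \<open>cnj (?c k t)\<close> equals \<open>cinner (\<phi> t) (e k)\<close>,
    the time integral of \<open>comm\<close> is the weak matrix entry of the commutator.\<close>
  define comm where "comm t = cinner (L (e j)) (\<phi> t) * cnj (?c k t) - ?c j t * cnj (cinner (L (e k)) (\<phi> t))" for t
  have comm_cont: "continuous_on {0..\<tau>} comm"
    unfolding comm_def by (intro continuous_intros continuous_on_cinner cont)
  have cc_cont: "continuous_on {0..\<tau>} (\<lambda>t. ?c j t * cnj (?c k t))"
    by (intro continuous_intros continuous_on_cinner cont)
  have FTC: "((\<lambda>t. \<i> * complex_of_real A * comm t - complex_of_real (lam j + lam k) * (?c j t * cnj (?c k t)))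
     has_integral ?c j \<tau> * cnj (?c k \<tau>) - ?c j 0 * cnj (?c k 0)) {0..\<tau>}"
  proof (rule fundamental_theorem_of_calculus[OF \<tau>])
    fix t assume t: "t \<in> {0..\<tau>}"
    let ?h = "\<lambda>j. \<i> * complex_of_real A * cinner (L (e j)) (\<phi> t) - complex_of_real (lam j) * ?c j t"
    have "((\<lambda>t. ?c j t * cnj (?c k t)) has_vector_derivative
        (?c j t * cnj (?h k) + ?h j * cnj (?c k t))) (at t within {0..\<tau>})"
      by (intro has_vector_derivative_mult has_vector_derivative_cnj solution_coeff_derivative[OF sol t])
    also have "?c j t * cnj (?h k) + ?h j * cnj (?c k t)
      = \<i> * complex_of_real A * comm t - complex_of_real (lam j + lam k) * (?c j t * cnj (?c k t))"
      by (simp add: comm_def algebra_simps)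
    finally show "((\<lambda>t. ?c j t * cnj (?c k t)) has_vector_derivative
       \<i> * complex_of_real A * comm t - complex_of_real (lam j + lam k) * (?c j t * cnj (?c k t)))
       (at t within {0..\<tau>})" .
  qed
  have "((\<lambda>t. \<i> * complex_of_real A * comm t - complex_of_real (lam j + lam k) * (?c j t * cnj (?c k t)))
     has_integral \<i> * complex_of_real A * integral {0..\<tau>} comm
       - complex_of_real (lam j + lam k) * integral {0..\<tau>} (\<lambda>t. ?c j t * cnj (?c k t))) {0..\<tau>}"
    by (intro has_integral_diff has_integral_mult_right integrable_integral
        integrable_continuous_real comm_cont cc_cont)
  from has_integral_unique[OF this FTC] have "\<i> * complex_of_real A * integral {0..\<tau>} comm
      = ?c j \<tau> * cnj (?c k \<tau>) - ?c j 0 * cnj (?c k 0)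
        + complex_of_real (lam j + lam k) * integral {0..\<tau>} (\<lambda>t. ?c j t * cnj (?c k t))"
    by (simp only: diff_eq_eq)
  then have "\<bar>A\<bar> * cmod (integral {0..\<tau>} comm) = cmod (?c j \<tau> * cnj (?c k \<tau>) - ?c j 0 * cnj (?c k 0)
        + complex_of_real (lam j + lam k) * integral {0..\<tau>} (\<lambda>t. ?c j t * cnj (?c k t)))"
    by (metis norm_mult norm_ii norm_of_real mult_1)
  \<comment> \<open>The boundary values at \<open>0\<close> and \<open>\<tau>\<close> contribute 1
    each; the dissipative term integrates a function of modulus at most 1.\<close>
  also have "\<dots> \<le> (1 + 1) + (lam j + lam k) * \<tau>"
  proof (intro norm_triangle_le add_mono norm_triangle_le_diff)
    show "cmod (?c j \<tau> * cnj (?c k \<tau>)) \<le> 1" "cmod (?c j 0 * cnj (?c k 0)) \<le> 1"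
      using ccle \<tau> by auto
    have "cmod (integral {0..\<tau>} (\<lambda>t. ?c j t * cnj (?c k t))) \<le> integral {0..\<tau>} (\<lambda>_. 1)"
      by (intro Henstock_Kurzweil_Integration.integral_norm_bound_integral
          integrable_continuous_real cc_cont ccle continuous_on_const)
    then have "cmod (integral {0..\<tau>} (\<lambda>t. ?c j t * cnj (?c k t))) \<le> \<tau>"
      using \<tau> by simp
    then show "cmod (complex_of_real (lam j + lam k) * integral {0..\<tau>} (\<lambda>t. ?c j t * cnj (?c k t)))
        \<le> (lam j + lam k) * \<tau>"
      using lam_pos[of j] lam_pos[of k] unfolding norm_mult norm_of_real by (intro mult_mono) auto
  qed
  also have "integral {0..\<tau>} comm
      = cinner (L (e j)) (time_average \<tau> \<phi> (e k)) - cinner (e j) (time_average \<tau> \<phi> (L (e k)))"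
    unfolding comm_def cinner_time_average[OF cont]
    by (subst Henstock_Kurzweil_Integration.integral_diff)
      (auto intro!: integrable_continuous_real continuous_intros continuous_on_cinner cont
        simp: cinner_commute[symmetric] mult.commute)
  finally show ?thesis by simp
qed

text \<open>In the overlap of \<open>\<phi>\<close> with \<psi>, \<open>L\<close> causes only a
  phase. Once it is removed, the rate of change is the \<Gamma> form of \<psi> and
  \<open>\<phi> t\<close>, at most half the sum of their energies. This costs at most
  \<open>1 / 4\<close> through \<open>\<phi>\<close>, besides the term from \<psi>, out of an
  initial overlap of 1.\<close>

lemma eigenvector_solution_norm_ge:
  assumes sol: "is_solution lam e L A \<psi> \<phi>" and \<tau>: "0 \<le> \<tau>" and norm: "norm \<psi> = 1"
    and \<psi>: "\<psi> \<in> sobolev lam e 1" and eig: "L \<psi> = \<mu> *\<^sub>C \<psi>"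
  shows "3 / 4 - \<tau> * (sobolev_norm lam e 1 \<psi>)\<^sup>2 / 2 \<le> norm (\<phi> \<tau>)"
proof -
  note cont = solution_continuous[OF sol, of \<tau>]
  let ?c = "\<lambda>j t. cinner (e j) (\<phi> t)" and ?K = "(sobolev_norm lam e 1 \<psi>)\<^sup>2"
  define m where "m = Re \<mu>"
  have "Im \<mu> = 0"
    using Im_cinner_L[OF sobolev_D[OF \<psi>]] norm by (simp add: eig cinner_scaleC_right cinner_self)
  then have \<mu>: "\<mu> = complex_of_real m" by (simp add: m_def complex_eq_iff)
  have \<phi>0: "\<phi> 0 = \<psi>" using sol by (simp add: is_solution_def)
  have le1: "norm (\<phi> t) \<le> 1" if "t \<in> {0..\<tau>}" for t
    using solution_norm_le[OF sol order_refl, of t] that norm \<phi>0 by simp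
  \<comment> \<open>The derivative is available for coefficients, so \<psi> is truncated;
    \<open>err N\<close> measures how far the truncation is from an eigenvector and tends to 0 while
    \<open>A\<close> is fixed.\<close>
  define err where "err N = norm (L (proj N \<psi>) - m *\<^sub>R proj N \<psi>)" for N
  have step: "cmod (cinner (proj N \<psi>) \<psi>) \<le> norm (\<phi> \<tau>) + (\<tau> * (\<bar>A\<bar> * err N + ?K / 2) + 1 / 4)" for N
  proof -
    \<comment> \<open>\<open>?E\<close> is the integrating factor that undoes the rotation of the
      overlap with frequency \<open>A * m\<close>.\<close>
    let ?a = "- \<i> * complex_of_real A * complex_of_real m"
    let ?E = "\<lambda>t. exp (?a * complex_of_real t)"
    define f where "f t = cinner (proj N \<psi>) (\<phi> t)" for t
    define d where "d t = \<i> * complex_of_real A * cinner (L (proj N \<psi>) - m *\<^sub>R proj N \<psi>) (\<phi> t)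
      - (\<Sum>j<N. complex_of_real (lam j) * (cnj (cinner (e j) \<psi>) * ?c j t))" for t
    have FTC: "((\<lambda>t. ?E t * d t) has_integral ?E \<tau> * f \<tau> - ?E 0 * f 0) {0..\<tau>}"
    proof (rule fundamental_theorem_of_calculus[OF \<tau>])
      fix t assume t: "t \<in> {0..\<tau>}"
      let ?h = "\<lambda>j. \<i> * complex_of_real A * cinner (L (e j)) (\<phi> t) - complex_of_real (lam j) * ?c j t"
      let ?df = "\<Sum>j<N. cnj (cinner (e j) \<psi>) * ?h j"
      have df: "(f has_vector_derivative ?df) (at t within {0..\<tau>})"
        unfolding f_def cinner_proj_left
        by (intro has_vector_derivative_sum has_vector_derivative_mult_right solution_coeff_derivative[OF sol t])
      have "(?E has_vector_derivative ?a * ?E t) (at t within {0..\<tau>})"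
        by (rule has_vector_derivative_real_field) (auto intro!: derivative_eq_intros)
      from has_vector_derivative_mult[OF this df]
      have "((\<lambda>t. ?E t * f t) has_vector_derivative (?E t * ?df + (?a * ?E t) * f t)) (at t within {0..\<tau>})" .
      also have "?E t * ?df + (?a * ?E t) * f t = ?E t * (?df + ?a * f t)" by (simp add: algebra_simps)
      also have "?df = \<i> * complex_of_real A * cinner (L (proj N \<psi>)) (\<phi> t)
        - (\<Sum>j<N. complex_of_real (lam j) * (cnj (cinner (e j) \<psi>) * ?c j t))"
        unfolding cinner_L_proj sum_distrib_left sum_subtractf[symmetric]
        by (intro sum.cong refl) (simp add: algebra_simps)
      also have "\<dots> + ?a * f t = d t"
        by (simp add: d_def f_def cinner_diff_left cinner_scaleR_left scaleR_conv_of_real algebra_simps)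
      finally show "((\<lambda>t. ?E t * f t) has_vector_derivative ?E t * d t) (at t within {0..\<tau>})" .
    qed
    have nE: "cmod (?E t) = 1" for t by (simp add: norm_exp_eq_Re)
    have d_le: "cmod (?E t * d t) \<le> (\<bar>A\<bar> * err N + ?K / 2) + energy N (\<phi> t) / 2" if t: "t \<in> {0..\<tau>}" for t
    proof -
      have "cmod (cinner (L (proj N \<psi>) - m *\<^sub>R proj N \<psi>) (\<phi> t)) \<le> err N * 1"
        unfolding err_def
        by (rule order_trans[OF norm_cinner_le]) (intro mult_left_mono le1[OF t] norm_ge_zero)
      then have 1: "cmod (\<i> * complex_of_real A * cinner (L (proj N \<psi>) - m *\<^sub>R proj N \<psi>) (\<phi> t)) \<le> \<bar>A\<bar> * err N"
        by (simp add: norm_mult mult_left_mono)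
      have "cmod (\<Sum>j<N. complex_of_real (lam j) * (cnj (cinner (e j) \<psi>) * ?c j t))
        \<le> (\<Sum>j<N. lam j * (cmod (cinner (e j) \<psi>))\<^sup>2 / 2 + lam j * (cmod (?c j t))\<^sup>2 / 2)"
      proof (rule sum_norm_le)
        fix j
        let ?x = "cmod (cinner (e j) \<psi>)" and ?y = "cmod (?c j t)"
        have "?x * ?y \<le> ?x\<^sup>2 / 2 + ?y\<^sup>2 / 2"
          using zero_le_power2[of "?x - ?y"] unfolding power2_diff by linarith
        from mult_left_mono[OF this less_imp_le[OF lam_pos[of j]]]
        show "cmod (complex_of_real (lam j) * (cnj (cinner (e j) \<psi>) * ?c j t)) \<le> lam j * ?x\<^sup>2 / 2 + lam j * ?y\<^sup>2 / 2"
          using lam_pos[of j] by (simp add: norm_mult algebra_simps)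
      qed
      also have "\<dots> = energy N \<psi> / 2 + energy N (\<phi> t) / 2"
        by (simp add: energy_def sum.distrib sum_divide_distrib)
      also have "\<dots> \<le> ?K / 2 + energy N (\<phi> t) / 2"
        using energy_le_sobolev_norm[OF \<psi>, of N] by simp
      finally show ?thesis
        using 1 norm_triangle_ineq4 by (fastforce simp: d_def norm_mult nE intro: order_trans)
    qed
    have "cmod (?E \<tau> * f \<tau> - ?E 0 * f 0) \<le> integral {0..\<tau>} (\<lambda>t. (\<bar>A\<bar> * err N + ?K / 2) + energy N (\<phi> t) / 2)"
      unfolding integral_unique[OF FTC, symmetric]
      by (rule Henstock_Kurzweil_Integration.integral_norm_bound_integral
          [OF has_integral_integrable[OF FTC] _ d_le])
        (intro integrable_continuous_real continuous_intros continuous_on_energy cont, simp_all)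
    also have "\<dots> = \<tau> * (\<bar>A\<bar> * err N + ?K / 2) + integral {0..\<tau>} (\<lambda>t. energy N (\<phi> t)) / 2"
      using \<tau> by (subst Henstock_Kurzweil_Integration.integral_add)
        (auto intro!: integrable_continuous_real continuous_intros continuous_on_energy cont)
    \<comment> \<open>The energy of \<open>\<phi>\<close> integrates to at most
      \<open>1 / 2\<close>, and half of it enters here.\<close>
    also have "\<dots> \<le> \<tau> * (\<bar>A\<bar> * err N + ?K / 2) + 1 / 4"
      using solution_energy_integral_le[OF sol norm \<tau>, of N] by simp
    finally have "cmod (?E 0 * f 0) - cmod (?E \<tau> * f \<tau>) \<le> \<tau> * (\<bar>A\<bar> * err N + ?K / 2) + 1 / 4"
      using norm_triangle_ineq2[of "?E 0 * f 0" "?E \<tau> * f \<tau>"] by (simp add: norm_minus_commute)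
    moreover have "cmod (f \<tau>) \<le> norm (\<phi> \<tau>)"
      unfolding f_def using norm_cinner_le[of "proj N \<psi>" "\<phi> \<tau>"]
        mult_right_mono[OF norm_proj_le[of N \<psi>], of "norm (\<phi> \<tau>)"] norm by simp
    ultimately show ?thesis using \<phi>0 by (simp add: norm_mult nE f_def)
  qed
  have "(\<lambda>N. L (proj N \<psi>) - m *\<^sub>R proj N \<psi>) \<longlonglongrightarrow> L \<psi> - m *\<^sub>R \<psi>"
    by (intro tendsto_intros L_proj_tendsto \<psi> proj_tendsto)
  then have "err \<longlonglongrightarrow> 0"
    unfolding err_def using tendsto_norm by (fastforce simp: eig \<mu> scaleR_scaleC)
  then have "(\<lambda>N. norm (\<phi> \<tau>) + (\<tau> * (\<bar>A\<bar> * err N + ?K / 2) + 1 / 4))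
    \<longlonglongrightarrow> norm (\<phi> \<tau>) + (\<tau> * (\<bar>A\<bar> * 0 + ?K / 2) + 1 / 4)"
    by (intro tendsto_intros)
  moreover have "(\<lambda>N. cmod (cinner (proj N \<psi>) \<psi>)) \<longlonglongrightarrow> cmod (cinner \<psi> \<psi>)"
    by (intro tendsto_intros tendsto_cinner proj_tendsto)
  ultimately have "cmod (cinner \<psi> \<psi>) \<le> norm (\<phi> \<tau>) + (\<tau> * (\<bar>A\<bar> * 0 + ?K / 2) + 1 / 4)"
    using step by (intro LIMSEQ_le) auto
  then show ?thesis by (simp add: cinner_self norm)
qed

end

section \<open>The dichotomy\<close>

context relatively_bounded
begin

text \<open>The top eigenspace of \<open>X\<close> lies in \<open>H\<^sup>1\<close> and is invariant under \<open>L\<close>, which is bounded there;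
  maximize the quadratic form of \<open>L\<close> on it.\<close>

lemma eigenvector_if_commuting:
  assumes add: "\<And>u v. X (u + v) = X u + X v" and scale: "\<And>a v. X (a *\<^sub>C v) = a *\<^sub>C X v"
    and sym: "\<And>u v. cinner u (X v) = cinner (X u) v"
    and bound: "\<And>v. norm (X v) \<le> K * norm v"
    and energy: "\<And>N v. energy N (X v) \<le> R * (norm v)\<^sup>2"
    and comm: "\<And>j k. cinner (L (e j)) (X (e k)) = cinner (e j) (X (L (e k)))"
    and pos: "0 < v0 \<bullet> X v0"
  shows "\<exists>\<psi>\<in>sobolev lam e 1. eigenvector D L \<psi>"
proof -
  have scaleR: "X (r *\<^sub>R v) = r *\<^sub>R X v" for r v by (simp add: scaleR_scaleC scale)
  have lin: "linear X" by (intro linearI add scaleR)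
  have X_lim: "(\<lambda>n. X (x n)) \<longlonglongrightarrow> X y" if "x \<longlonglongrightarrow> y" for x y
  proof -
    have "bounded_linear X"
      by (rule bounded_linear_intro[of _ K]) (auto simp: add scaleR bound mult.commute)
    then show ?thesis using that by (rule bounded_linear.tendsto)
  qed
  have X_sobolev: "X v \<in> sobolev lam e 1" for v
    by (rule sobolev_if_energy_le) (rule energy)
  have v0: "v0 \<noteq> 0" using pos by auto
  have sym': "u \<bullet> X v = X u \<bullet> v" for u v by (simp add: inner_eq_Re_cinner sym)
  obtain M x where x: "\<And>n. norm (x n :: 'h) = 1" "(\<lambda>n. X (x n) - M *\<^sub>R x n) \<longlonglongrightarrow> 0"
    and M: "\<And>y. y \<bullet> X y \<le> M * (norm y)\<^sup>2"
    by (rule approximate_eigenvectors[of UNIV v0 X K])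
      (use v0 sym' in \<open>auto simp: add scaleR bound\<close>)
  have Mpos: "M > 0"
  proof -
    have "0 < M * (norm v0)\<^sup>2" using M[of v0] pos by linarith
    then show ?thesis by (simp add: zero_less_mult_iff)
  qed
  obtain r y where r: "strict_mono (r :: nat \<Rightarrow> nat)" and y: "(\<lambda>n. X (x (r n))) \<longlonglongrightarrow> y"
    by (rule convergent_subsequence[of "\<lambda>n. X (x n)" K R])
      (use bound[of "x _"] energy[of _ "x _"] x(1) in simp_all)
  \<comment> \<open>Compactness gives convergence of \<open>X (x (r n))\<close> only; as
    \<open>X (x n) - M *\<^sub>R x n\<close> tends to 0 and \<open>M > 0\<close>, the vectors
    \<open>x (r n)\<close> converge too.\<close>
  have "(\<lambda>n. (1 / M) *\<^sub>R (X (x (r n)) - (X (x (r n)) - M *\<^sub>R x (r n)))) \<longlonglongrightarrow> (1 / M) *\<^sub>R (y - 0)"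
    by (intro tendsto_intros y LIMSEQ_subseq_LIMSEQ[OF x(2) r, unfolded o_def])
  then have z: "(\<lambda>n. x (r n)) \<longlonglongrightarrow> (1 / M) *\<^sub>R y" using Mpos by simp
  define z where "z = (1 / M) *\<^sub>R y"
  have "norm z = 1"
    using tendsto_norm[OF z, folded z_def] unfolding x(1) LIMSEQ_const_iff by simp
  then have z0: "z \<noteq> 0" by auto
  have Xz: "X z = M *\<^sub>R z"
    using LIMSEQ_unique[OF X_lim[OF z] y] Mpos by (simp add: z_def)
  define E where "E = {v. X v = M *\<^sub>R v}"
  have E: "subspace E"
    by (auto simp: subspace_def E_def add scaleR linear_0[OF lin] algebra_simps)
  define R' where "R' = R / M\<^sup>2"
  \<comment> \<open>On \<open>E\<close> each \<open>v\<close> is \<open>X v\<close> divided by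
    \<open>M\<close>, so the smoothing bound for \<open>X\<close> controls the H^1 norm by the norm
    of H; hence \<open>L\<close> is bounded on \<open>E\<close>.\<close>
  have E_energy: "energy N v \<le> R' * (norm v)\<^sup>2" if "v \<in> E" for N v
  proof -
    have "v = (1 / M) *\<^sub>R X v" using that Mpos by (simp add: E_def)
    then have "energy N v = (1 / M)\<^sup>2 * energy N (X v)" using energy_scaleR by metis
    also have "\<dots> \<le> (1 / M)\<^sup>2 * (R * (norm v)\<^sup>2)" by (intro mult_left_mono energy) simp
    finally show ?thesis by (simp add: R'_def power_divide)
  qed
  have E_sobolev: "v \<in> sobolev lam e 1" if "v \<in> E" for v
    using E_energy[OF that] by (rule sobolev_if_energy_le)
  note E_D = sobolev_D[OF E_sobolev]
  have E_bound: "norm (L v) \<le> (\<bar>C\<bar> * sqrt R') * norm v" if "v \<in> E" for v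
  proof -
    have "(sobolev_norm lam e 1 v)\<^sup>2 \<le> R' * (norm v)\<^sup>2"
      using E_energy[OF that] by (rule sobolev_norm_if_energy_le)
    from real_sqrt_le_mono[OF this] have "sobolev_norm lam e 1 v \<le> sqrt R' * norm v"
      using sobolev_norm_nonneg[OF E_sobolev[OF that]] by (simp add: real_sqrt_mult)
    then have "\<bar>C\<bar> * sobolev_norm lam e 1 v \<le> \<bar>C\<bar> * (sqrt R' * norm v)"
      by (rule mult_left_mono) simp
    moreover have "C * sobolev_norm lam e 1 v \<le> \<bar>C\<bar> * sobolev_norm lam e 1 v"
      by (intro mult_right_mono sobolev_norm_nonneg E_sobolev that) simp
    ultimately show ?thesis using norm_L_le[OF E_sobolev[OF that]] by simp
  qed
  have E_L: "L v \<in> E" if v: "v \<in> E" for v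
  proof -
    \<comment> \<open>A priori \<open>L v\<close> need not lie in \<open>D\<close>, so commutation
      is applied to basis vectors: since \<open>X (e j)\<close> lies in \<open>D\<close>, the
      entries \<open>comm\<close> combine to \<open>L (X (e j)) = X (L (e j))\<close>.\<close>
    have "cinner (e j) (X (L v)) = cinner (e j) (M *\<^sub>R L v)" for j
    proof -
      have LX: "L (X (e j)) = X (L (e j))"
      proof (rule eq_if_coeffs_eq)
        show "cinner (e i) (L (X (e j))) = cinner (e i) (X (L (e j)))" for i
          using comm[of i j] symmetric_L[OF e_in_D sobolev_D[OF X_sobolev], of i "e j"] by simp
      qed
      have "cinner (e j) (X (L v)) = cinner (X (e j)) (L v)" by (rule sym)
      also have "\<dots> = cinner (L (X (e j))) v"
        by (rule symmetric_L[OF sobolev_D[OF X_sobolev] E_D[OF v], symmetric])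
      also have "\<dots> = cinner (L (e j)) (X v)" by (simp add: LX sym)
      also have "\<dots> = M *\<^sub>R cinner (L (e j)) v" using v by (simp add: E_def cinner_scaleR_right)
      also have "\<dots> = cinner (e j) (M *\<^sub>R L v)"
        by (simp add: symmetric_L[OF e_in_D E_D[OF v]] cinner_scaleR_right)
      finally show ?thesis .
    qed
    from eq_if_coeffs_eq[OF this] show ?thesis by (simp add: E_def)
  qed
  have zE: "z \<in> E" using Xz by (simp add: E_def)
  obtain \<mu> y where y: "\<And>n. y n \<in> E" "\<And>n. norm (y n) = 1" "(\<lambda>n. L (y n) - \<mu> *\<^sub>R y n) \<longlonglongrightarrow> 0"
    by (rule approximate_eigenvectors[OF E zE z0 E_L])
      (use E_bound in \<open>auto simp: L_add L_scaleR E_D inner_eq_Re_cinner symmetric_L\<close>)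
  \<comment> \<open>The H^1 bound on unit vectors of \<open>E\<close> gives a convergent
    subsequence; boundedness of \<open>L\<close> on \<open>E\<close> then carries the eigenvalue
    equation to the limit.\<close>
  obtain s w where s: "strict_mono (s :: nat \<Rightarrow> nat)" and w: "(\<lambda>n. y (s n)) \<longlonglongrightarrow> w"
    by (rule convergent_subsequence[of y 1 R']) (use E_energy[OF y(1)] y(2) in simp_all)
  have wE: "w \<in> E"
    using LIMSEQ_unique[OF X_lim[OF w], of "M *\<^sub>R w"] tendsto_scaleR[OF tendsto_const w, of M] y(1)
    by (simp add: E_def)
  have "(\<lambda>n. L (y (s n)) - L w) \<longlonglongrightarrow> 0"
  proof (rule Lim_null_comparison)
    have "norm (L (y (s n)) - L w) \<le> (\<bar>C\<bar> * sqrt R') * norm (y (s n) - w)" for n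
      using E_bound[OF subspace_diff[OF E y(1) wE], of "s n"] L_diff[OF E_D[OF y(1)] E_D[OF wE], of "s n"]
      by simp
    then show "\<forall>\<^sub>F n in sequentially. norm (L (y (s n)) - L w) \<le> (\<bar>C\<bar> * sqrt R') * norm (y (s n) - w)"
      by simp
    show "(\<lambda>n. (\<bar>C\<bar> * sqrt R') * norm (y (s n) - w)) \<longlonglongrightarrow> 0"
      by (intro tendsto_mult_right_zero tendsto_norm_zero LIM_zero w)
  qed
  then have "(\<lambda>n. L (y (s n)) - \<mu> *\<^sub>R y (s n)) \<longlonglongrightarrow> L w - \<mu> *\<^sub>R w"
    by (intro tendsto_intros w) (rule LIM_zero_cancel)
  from LIMSEQ_unique[OF this LIMSEQ_subseq_LIMSEQ[OF y(3) s, unfolded o_def]]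
  have "L w = complex_of_real \<mu> *\<^sub>C w" by (simp add: scaleR_scaleC)
  moreover have "norm w = 1"
    using tendsto_norm[OF w] unfolding y(2) LIMSEQ_const_iff by simp
  ultimately have "eigenvector D L w"
    using E_D[OF wE] unfolding eigenvector_def by auto
  then show ?thesis using E_sobolev[OF wE] by blast
qed

text \<open>Compactness by contradiction: counterexamples with \<open>A n > n\<close> yield time
  averages whose limit \<open>X\<close> satisfies the hypotheses of
  \<open>eigenvector_if_commuting\<close>.\<close>

lemma solution_norm_small:
  assumes sol: "\<And>A \<phi>0. is_solution lam e L A \<phi>0 (\<phi> A \<phi>0)"
    and no_eigenvector: "\<not> (\<exists>\<psi>\<in>sobolev lam e 1. eigenvector D L \<psi>)"
    and \<tau>: "\<tau> > 0" and \<delta>: "\<delta> > 0"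
  shows "\<exists>A0. \<forall>A>A0. \<forall>\<phi>0. norm \<phi>0 = 1 \<longrightarrow> (norm (\<phi> A \<phi>0 \<tau>))\<^sup>2 < \<delta>"
proof (rule ccontr)
  assume "\<not> ?thesis"
  then have "\<forall>n. \<exists>A \<phi>0. A > real n \<and> norm \<phi>0 = 1 \<and> \<delta> \<le> (norm (\<phi> A \<phi>0 \<tau>))\<^sup>2"
    by (meson not_le)
  then obtain A \<phi>0 where A: "A n > real n" and norm: "norm (\<phi>0 n) = 1"
    and ge: "\<delta> \<le> (norm (\<phi> (A n) (\<phi>0 n) \<tau>))\<^sup>2" for n
    by metis
  define f where "f n = \<phi> (A n) (\<phi>0 n)" for n
  have sol: "is_solution lam e L (A n) (\<phi>0 n) (f n)" for n unfolding f_def by (rule sol)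
  note cont = solution_continuous[OF sol, where \<tau> = \<tau>]
  have \<tau>0: "0 \<le> \<tau>" using \<tau> by simp
  have le1: "norm (f n t) \<le> 1" if "t \<in> {0..\<tau>}" for n t
    using solution_norm_le[OF sol order_refl, of t n] that norm[of n] sol[of n]
    by (simp add: is_solution_def)
  \<comment> \<open>The norm is nonincreasing in time, so the lower bound at the final time holds on
    the whole interval.\<close>
  have ge': "\<delta> \<le> (norm (f n t))\<^sup>2" if "t \<in> {0..\<tau>}" for n t
  proof -
    have "norm (f n \<tau>) \<le> norm (f n t)"
      by (rule solution_norm_le[OF sol]) (use that in auto)
    then have "(norm (f n \<tau>))\<^sup>2 \<le> (norm (f n t))\<^sup>2" by (rule power_mono) simp
    then show ?thesis using ge[of n] unfolding f_def by linarith
  qed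
  note en = solution_energy_integral_le[OF sol norm \<tau>0]
  obtain r :: "nat \<Rightarrow> nat" and X where r: "strict_mono r"
    and X: "\<And>v. (\<lambda>n. time_average \<tau> (f (r n)) v) \<longlonglongrightarrow> X v"
    by (rule time_average_subsequence[of \<tau> f, OF cont \<tau>0 en le1]) blast+
  have "\<exists>\<psi>\<in>sobolev lam e 1. eigenvector D L \<psi>"
  proof -
    have add: "X (u + v) = X u + X v" for u v
      using LIMSEQ_unique[OF X[of "u + v"]] tendsto_add[OF X[of u] X[of v]]
      by (simp add: time_average_add[OF cont])
    have scale: "X (a *\<^sub>C v) = a *\<^sub>C X v" for a v
      using LIMSEQ_unique[OF X[of "a *\<^sub>C v"]]
        bounded_bilinear.tendsto[OF bounded_bilinear_scaleC tendsto_const X[of v], of a]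
      by (simp add: time_average_scaleC[OF cont])
    have sym: "cinner u (X v) = cinner (X u) v" for u v
      using LIMSEQ_unique[OF tendsto_cinner[OF tendsto_const X[of v], of u]]
        tendsto_cinner[OF X[of u] tendsto_const, of v]
      by (simp add: cinner_time_average_commute[OF cont])
    have bound: "norm (X v) \<le> \<tau> * norm v" for v
      by (rule LIMSEQ_le_const2[OF tendsto_norm[OF X]]) (use norm_time_average_le[OF cont \<tau>0 le1] in blast)
    have energy: "energy N (X v) \<le> \<tau> * (1 / 2) * (norm v)\<^sup>2" for N v
      by (rule energy_tendsto_le[OF X]) (rule energy_time_average_le[OF cont \<tau>0 en le1])
    have comm: "cinner (L (e j)) (X (e k)) = cinner (e j) (X (L (e k)))" for j k
    proof -
      let ?d = "\<lambda>n. cinner (L (e j)) (time_average \<tau> (f (r n)) (e k))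
        - cinner (e j) (time_average \<tau> (f (r n)) (L (e k)))"
      let ?c = "2 + (lam j + lam k) * \<tau>"
      have "?d \<longlonglongrightarrow> 0"
      proof (rule Lim_null_comparison)
        show "(\<lambda>n. ?c / real n) \<longlonglongrightarrow> 0" by (rule lim_const_over_n)
        show "\<forall>\<^sub>F n in sequentially. norm (?d n) \<le> ?c / real n"
          using eventually_gt_at_top[of 0]
        proof eventually_elim
          case (elim n)
          \<comment> \<open>A strictly increasing \<open>r\<close> has \<open>r n \<ge> n\<close>,
            so \<open>A (r n)\<close> exceeds \<open>n\<close>.\<close>
          have "real n \<le> \<bar>A (r n)\<bar>" using A[of "r n"] seq_suble[OF r, of n] by linarith
          then have "real n * cmod (?d n) \<le> \<bar>A (r n)\<bar> * cmod (?d n)" by (rule mult_right_mono) simp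
          also have "\<dots> \<le> ?c" by (rule time_average_commutator[OF sol \<tau>0 norm])
          finally show ?case using elim by (simp add: field_simps)
        qed
      qed
      moreover have "?d \<longlonglongrightarrow> cinner (L (e j)) (X (e k)) - cinner (e j) (X (L (e k)))"
        by (intro tendsto_diff tendsto_cinner X tendsto_const)
      ultimately show ?thesis using LIMSEQ_unique by fastforce
    qed
    \<comment> \<open>With integrated energy at most \<open>1 / 2\<close>, less than
      \<open>\<tau> * \<delta>\<close> of the trace can lie beyond this \<open>N\<close>, so the
      partial trace stays positive in the limit.\<close>
    obtain N where N: "lam N > 1 / (\<tau> * \<delta>)"
      using lam_at_top unfolding filterlim_at_top_dense eventually_sequentially by blast
    have "\<tau> * \<delta> - 1 / 2 / lam N \<le> (\<Sum>j<N. Re (cinner (e j) (X (e j))))"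
    proof (rule LIMSEQ_le_const)
      show "(\<lambda>n. \<Sum>j<N. Re (cinner (e j) (time_average \<tau> (f (r n)) (e j))))
          \<longlonglongrightarrow> (\<Sum>j<N. Re (cinner (e j) (X (e j))))"
        by (intro tendsto_sum tendsto_Re tendsto_cinner X tendsto_const)
      show "\<exists>n0. \<forall>n\<ge>n0. \<tau> * \<delta> - 1 / 2 / lam N
          \<le> (\<Sum>j<N. Re (cinner (e j) (time_average \<tau> (f (r n)) (e j))))"
        using time_average_trace_ge[OF cont \<tau>0 en le1 ge'] by blast
    qed
    moreover have "1 / 2 / lam N < \<tau> * \<delta>"
    proof -
      have "1 < \<tau> * \<delta> * lam N" using N \<tau> \<delta> by (simp add: field_simps)
      then show ?thesis using lam_pos[of N] by (simp add: field_simps)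
    qed
    ultimately have "0 < (\<Sum>j<N. Re (cinner (e j) (X (e j))))" by linarith
    \<comment> \<open>A positive partial trace has a positive diagonal entry, and \<open>e j\<close>
      serves as the test vector \<open>v0\<close>.\<close>
    then obtain j where "0 < e j \<bullet> X (e j)"
      unfolding inner_eq_Re_cinner by (meson not_le sum_nonpos)
    from eigenvector_if_commuting[OF add scale sym bound energy comm this] show ?thesis .
  qed
  with no_eigenvector show False by contradiction
qed

text \<open>The initial vector and the time are fixed before \<open>A\<close>, so decay fails for
  every \<open>A\<close> at once.\<close>

lemma solution_norm_not_small:
  assumes sol: "\<And>A \<phi>0. is_solution lam e L A \<phi>0 (\<phi> A \<phi>0)"
    and \<psi>: "\<psi> \<in> sobolev lam e 1" and eig: "eigenvector D L \<psi>"
  obtains \<psi>' \<tau> where "norm \<psi>' = 1" "\<tau> > 0" "\<And>A. 1 / 4 \<le> (norm (\<phi> A \<psi>' \<tau>))\<^sup>2"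
proof -
  obtain \<mu> where \<mu>: "L \<psi> = \<mu> *\<^sub>C \<psi>" "\<psi> \<noteq> 0" using eig unfolding eigenvector_def by blast
  define \<psi>' where "\<psi>' = complex_of_real (1 / norm \<psi>) *\<^sub>C \<psi>"
  have \<psi>': "\<psi>' \<in> sobolev lam e 1" "norm \<psi>' = 1" "L \<psi>' = \<mu> *\<^sub>C \<psi>'"
    using \<psi> \<mu> unfolding \<psi>'_def
    by (simp_all add: sobolev_scaleC norm_scaleC norm_divide L_scaleC[OF sobolev_D] scaleC_scaleC mult.commute)
  define K where "K = (sobolev_norm lam e 1 \<psi>')\<^sup>2"
  \<comment> \<open>Chosen so that \<open>\<tau> * K / 2 \<le> 1 / 4\<close>: the norm is then at
    least 3/4 - 1/4 = 1/2, whose square is \<open>1 / 4\<close>.\<close>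
  define \<tau> where "\<tau> = 1 / (2 * (K + 1))"
  have K: "0 \<le> K" by (simp add: K_def)
  then have \<tau>: "\<tau> > 0" "\<tau> * K / 2 \<le> 1 / 4" by (simp_all add: \<tau>_def field_simps)
  have "1 / 4 \<le> (norm (\<phi> A \<psi>' \<tau>))\<^sup>2" for A
  proof -
    have "1 / 2 \<le> norm (\<phi> A \<psi>' \<tau>)"
      using eigenvector_solution_norm_ge[OF sol less_imp_le[OF \<tau>(1)] \<psi>'(2,1,3), of A] \<tau>(2)
      unfolding K_def by linarith
    from power_mono[OF this, of 2] show ?thesis by (simp add: power_divide)
  qed
  with \<psi>'(2) \<tau>(1) that show thesis by blast
qed

end

lemma self_adjoint_symmetric:
  assumes "self_adjoint D T" "x \<in> D" "y \<in> D"
  shows "cinner (T x) y = cinner x (T y)"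
proof -
  have "(y, T y) \<in> adjoint_graph D T"
    using assms unfolding self_adjoint_def operator_graph_def by blast
  then show ?thesis using assms(2) by (simp add: adjoint_graph_def)
qed

theorem theorem1p4:
  fixes Gam L :: "'h::chilbert_space \<Rightarrow> 'h"
    and D_Gam D_L :: "'h set"
    and lam :: "nat \<Rightarrow> real"
    and e :: "nat \<Rightarrow> 'h"
    and U :: "real \<Rightarrow> 'h \<Rightarrow> 'h"
    and C :: real
    and B :: "real \<Rightarrow> real"
    and \<phi> :: "real \<Rightarrow> 'h \<Rightarrow> real \<Rightarrow> 'h"
  assumes "separable_space (euclidean :: 'h topology)"
    and "self_adjoint D_Gam Gam"
    and "positive_operator D_Gam Gam"
    and "unbounded_operator D_Gam Gam"
    and "discrete_spectrum D_Gam Gam lam e"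
    and "self_adjoint D_L L"
    and "unitary_group_generated_by D_L L U"
    and "\<And>\<psi>. \<psi> \<in> sobolev lam e 1 \<Longrightarrow>
           \<psi> \<in> D_L \<and> norm (L \<psi>) \<le> C * sobolev_norm lam e 1 \<psi>"
    and "\<And>\<psi> t. \<psi> \<in> sobolev lam e 1 \<Longrightarrow> t > 0 \<Longrightarrow>
           U t \<psi> \<in> sobolev lam e 1 \<and>
           sobolev_norm lam e 1 (U t \<psi>) \<le> B t * sobolev_norm lam e 1 \<psi>"
    and "L2_loc_nonneg B"
    and "\<And>A \<phi>0. is_solution lam e L A \<phi>0 (\<phi> A \<phi>0)"
  shows "(\<forall>\<tau>>0. \<forall>\<delta>>0. \<exists>A0. \<forall>A>A0. \<forall>\<phi>0. norm \<phi>0 = 1 \<longrightarrow> (norm (\<phi> A \<phi>0 \<tau>))\<^sup>2 < \<delta>)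
     \<longleftrightarrow> \<not> (\<exists>\<psi>\<in>sobolev lam e 1. eigenvector D_L L \<psi>)"
proof -
  interpret relatively_bounded lam e D_L L C
  proof
    show "0 < lam 0" "mono lam" "filterlim lam at_top sequentially" "orthonormal_basis e"
      using assms(5) by (simp_all add: discrete_spectrum_def)
    show "csubspace D_L" "clinear_on D_L L"
      using assms(6) by (simp_all add: self_adjoint_def densely_defined_operator_def)
  qed (use assms(8) self_adjoint_symmetric[OF assms(6)] in auto)
  show ?thesis
  proof
    assume small: "\<forall>\<tau>>0. \<forall>\<delta>>0. \<exists>A0. \<forall>A>A0. \<forall>\<phi>0. norm \<phi>0 = 1 \<longrightarrow> (norm (\<phi> A \<phi>0 \<tau>))\<^sup>2 < \<delta>"
    show "\<not> (\<exists>\<psi>\<in>sobolev lam e 1. eigenvector D_L L \<psi>)"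
    proof
      assume "\<exists>\<psi>\<in>sobolev lam e 1. eigenvector D_L L \<psi>"
      then obtain \<psi> \<tau> where "norm \<psi> = 1" "\<tau> > 0" and ge: "\<And>A. 1 / 4 \<le> (norm (\<phi> A \<psi> \<tau>))\<^sup>2"
        using solution_norm_not_small[OF assms(11)] by metis
      moreover obtain A0 where "\<forall>A>A0. \<forall>\<phi>0. norm \<phi>0 = 1 \<longrightarrow> (norm (\<phi> A \<phi>0 \<tau>))\<^sup>2 < 1 / 4"
        using small[rule_format, OF \<open>\<tau> > 0\<close>, of "1 / 4"] by auto
      ultimately have "(norm (\<phi> (A0 + 1) \<psi> \<tau>))\<^sup>2 < 1 / 4" by simp
      then show False using ge[of "A0 + 1"] by simp
    qed
  next
    assume "\<not> (\<exists>\<psi>\<in>sobolev lam e 1. eigenvector D_L L \<psi>)"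
    then show "\<forall>\<tau>>0. \<forall>\<delta>>0. \<exists>A0. \<forall>A>A0. \<forall>\<phi>0. norm \<phi>0 = 1 \<longrightarrow> (norm (\<phi> A \<phi>0 \<tau>))\<^sup>2 < \<delta>"
      using solution_norm_small[OF assms(11)] by blast
  qed
qed

end
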